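(* Let $K\in\{\mathbb{R},\mathbb{C},\mathbb{H}\}$, let $d\ge 1$, and put $$\beta=\sqrt{\frac{1}{d+2(\dim_{\mathbb{R}}K)^{-1}}},\qquad M=d+\frac{d^2-d}{2}\dim_{\mathbb{R}}K .$$ Let $q\in[1,2]$. For any isotropic measure $\mu$ on $K^d$, $$\mathbb{E}_{x,y\sim\mu}|\langle x,y\rangle|^q\le\beta^q+\frac{1-\beta^q}{M}.$$ Moreover, for $q\in[1,2)$, equality is possible only if there exists a maximal simplex (of size $M$) in $K\mathbb{P}^{d-1}$, and in the case of equality $\mu$ is the uniform distribution over a maximal simplex, i.e. $\mu$ is concentrated on unit vectors and its image in $K\mathbb{P}^{d-1}$ is the uniform probability measure on the $M$ points of a maximal simplex.
   Context: $K^d$ carries the Hermitian product $\langle x,y\rangle=x^*y$ ($x^*$ is the conjugate transpose; for $K=\mathbb{H}$, $K^d$ is a right vector space). $K\mathbb{P}^{d-1}=(K^d\setminus\{0\})/K^\times$ with $x\sim xe$, $e\in K^\times$; points of $K\mathbb{P}^{d-1}$ are represented by unit vectors. An isotropic measure on $K^d$ is a Borel probability measure $\mu$ with $\mathbb{E}_{x\sim\mu}\,xx^*=\frac1d I_d$. Here $\mathbb{E}_{x,y\sim\mu}|\langle x,y\rangle|^q=\int\int|\langle x,y\rangle|^q\,d\mu(x)\,d\mu(y)$. A regular simplex in $K\mathbb{P}^{d-1}$ is a set of distinct points $\{x_1,\ldots,x_N\}$ for which $|\langle x_i,x_j\rangle|$ (computed with unit representatives) is the same for all $i\ne j$. A regular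 simplex always has at most $d+\frac{d^2-d}{2}\dim_{\mathbb{R}}K$ points; a maximal simplex is a regular simplex with exactly this many points. *)

theory Defs
  imports "HOL-Probability.Probability"
begin

section \<open>Quaternions\<close>

datatype quat = Quat (qRe: real) (qI: real) (qJ: real) (qK: real)

lemma quat_eq_iff:
  "x = y \<longleftrightarrow> qRe x = qRe y \<and> qI x = qI y \<and> qJ x = qJ y \<and> qK x = qK y"
  by (cases x; cases y) simp

instantiation quat :: ab_group_add
begin

definition "0 = Quat 0 0 0 0"
definition "x + y = Quat (qRe x + qRe y) (qI x + qI y) (qJ x + qJ y) (qK x + qK y)"
definition "- x = Quat (- qRe x) (- qI x) (- qJ x) (- qK x)"
definition "x - y = Quat (qRe x - qRe y) (qI x - qI y) (qJ x - qJ y) (qK x - qK y)"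

instance
  by standard
    (simp_all add: quat_eq_iff zero_quat_def plus_quat_def uminus_quat_def minus_quat_def)

end

lemma quat_zero_sel [simp]: "qRe 0 = 0" "qI 0 = 0" "qJ 0 = 0" "qK 0 = 0"
  by (simp_all add: zero_quat_def)

lemma quat_plus_sel [simp]:
  "qRe (x + y) = qRe x + qRe y" "qI (x + y) = qI x + qI y"
  "qJ (x + y) = qJ x + qJ y" "qK (x + y) = qK x + qK y"
  by (simp_all add: plus_quat_def)

lemma quat_uminus_sel [simp]:
  "qRe (- x) = - qRe x" "qI (- x) = - qI x" "qJ (- x) = - qJ x" "qK (- x) = - qK x"
  by (simp_all add: uminus_quat_def)

lemma quat_minus_sel [simp]:
  "qRe (x - y) = qRe x - qRe y" "qI (x - y) = qI x - qI y"
  "qJ (x - y) = qJ x - qJ y" "qK (x - y) = qK x - qK y"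
  by (simp_all add: minus_quat_def)

instantiation quat :: real_vector
begin

definition "scaleR r x = Quat (r * qRe x) (r * qI x) (r * qJ x) (r * qK x)"

instance
  by standard (simp_all add: quat_eq_iff scaleR_quat_def algebra_simps)

end

lemma quat_scaleR_sel [simp]:
  "qRe (r *\<^sub>R x) = r * qRe x" "qI (r *\<^sub>R x) = r * qI x"
  "qJ (r *\<^sub>R x) = r * qJ x" "qK (r *\<^sub>R x) = r * qK x"
  by (simp_all add: scaleR_quat_def)

instantiation quat :: real_inner
begin

definition "inner x y = qRe x * qRe y + qI x * qI y + qJ x * qJ y + qK x * qK y"
definition "norm (x :: quat) = sqrt (inner x x)"
definition "sgn (x :: quat) = x /\<^sub>R norm x"
definition "dist (x :: quat) y = norm (x - y)"
definition [code del]: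
  "(uniformity :: (quat \<times> quat) filter) = (INF e\<in>{0<..}. principal {(x, y). dist x y < e})"
definition [code del]:
  "open (U :: quat set) \<longleftrightarrow> (\<forall>x\<in>U. eventually (\<lambda>(x', y). x' = x \<longrightarrow> y \<in> U) uniformity)"

instance
proof
  fix x :: quat
  show "inner x x = 0 \<longleftrightarrow> x = 0"
  proof
    assume "inner x x = 0"
    then have "(qRe x)\<^sup>2 + (qI x)\<^sup>2 + (qJ x)\<^sup>2 + (qK x)\<^sup>2 = 0"
      by (simp add: inner_quat_def power2_eq_square)
    then show "x = 0"
      by (simp add: quat_eq_iff add_nonneg_eq_0_iff)
  qed (simp add: inner_quat_def)
qed (simp_all add: inner_quat_def norm_quat_def sgn_quat_def
      dist_quat_def uniformity_quat_def open_quat_def algebra_simps)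

end

lemma norm_quat_power2: "(norm x)\<^sup>2 = (qRe x)\<^sup>2 + (qI x)\<^sup>2 + (qJ x)\<^sup>2 + (qK x)\<^sup>2"
  unfolding power2_norm_eq_inner inner_quat_def by (simp add: power2_eq_square)

instantiation quat :: real_normed_div_algebra
begin

definition "1 = Quat 1 0 0 0"
definition "x * y = Quat
  (qRe x * qRe y - qI x * qI y - qJ x * qJ y - qK x * qK y)
  (qRe x * qI y + qI x * qRe y + qJ x * qK y - qK x * qJ y)
  (qRe x * qJ y - qI x * qK y + qJ x * qRe y + qK x * qI y)
  (qRe x * qK y + qI x * qJ y - qJ x * qI y + qK x * qRe y)"
definition "inverse x = Quat (qRe x) (- qI x) (- qJ x) (- qK x) /\<^sub>R (norm x)\<^sup>2"
definition "x div (y :: quat) = x * inverse y"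

instance
proof
  fix x y :: quat
  show "norm (x * y) = norm x * norm y"
  proof (rule power2_eq_imp_eq)
    show "(norm (x * y))\<^sup>2 = (norm x * norm y)\<^sup>2"
      unfolding power_mult_distrib norm_quat_power2 by (simp add: times_quat_def power2_eq_square algebra_simps)
  qed simp_all
next
  fix x :: quat
  assume "x \<noteq> 0"
  then have nz: "norm x ^ 2 \<noteq> 0" by simp
  have l: "Quat (qRe x) (- qI x) (- qJ x) (- qK x) * x = (norm x)\<^sup>2 *\<^sub>R 1"
   and r: "x * Quat (qRe x) (- qI x) (- qJ x) (- qK x) = (norm x)\<^sup>2 *\<^sub>R 1"
    unfolding norm_quat_power2
    by (simp_all add: quat_eq_iff times_quat_def one_quat_def power2_eq_square algebra_simps)
  have sl: "(c *\<^sub>R a) * b = c *\<^sub>R (a * b)" and sr: "a * (c *\<^sub>R b) = c *\<^sub>R (a * b)"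
    for a b :: quat and c
    by (simp_all add: quat_eq_iff times_quat_def algebra_simps)
  show "inverse x * x = 1" "x * inverse x = 1"
    using nz by (simp_all add: inverse_quat_def sl sr l r)
qed (simp_all add: quat_eq_iff times_quat_def one_quat_def inverse_quat_def
      divide_quat_def algebra_simps)

end

instantiation quat :: euclidean_space
begin

definition "Basis = {Quat 1 0 0 0, Quat 0 1 0 0, Quat 0 0 1 0, Quat 0 0 0 1}"

instance
proof
  fix u v :: quat
  assume "u \<in> Basis" "v \<in> Basis"
  then show "inner u v = (if u = v then 1 else 0)"
    unfolding Basis_quat_def by (elim insertE emptyE) (simp_all add: inner_quat_def)
next
  fix x :: quat
  show "(\<forall>u\<in>Basis. inner x u = 0) \<longleftrightarrow> x = 0"
    by (simp add: Basis_quat_def inner_quat_def quat_eq_iff [of x 0])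
qed (simp_all add: Basis_quat_def)

end

lemma DIM_quat [simp]: "DIM(quat) = 4"
  by (simp add: Basis_quat_def)


section \<open>Division algebras with conjugation\<close>

text \<open>
  A common interface to the reals, the complex numbers and the quaternions, so that the
  notions below need to be defined only once.
\<close>

class conj_div_algebra = real_normed_div_algebra + euclidean_space +
  fixes conjugate :: "'a \<Rightarrow> 'a"
  assumes conjugate_add: "conjugate (x + y) = conjugate x + conjugate y"
    and conjugate_scaleR: "conjugate (r *\<^sub>R x) = r *\<^sub>R conjugate x"
    and conjugate_mult: "conjugate (x * y) = conjugate y * conjugate x"
    and conjugate_conjugate: "conjugate (conjugate x) = x"
    and conjugate_mult_self: "conjugate x * x = (norm x)\<^sup>2 *\<^sub>R 1"

instantiation real :: conj_div_algebra
begin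

definition conjugate_real :: "real \<Rightarrow> real" where "conjugate_real x = x"

instance
  by standard (simp_all add: conjugate_real_def power2_eq_square)

end

instantiation complex :: conj_div_algebra
begin

definition conjugate_complex :: "complex \<Rightarrow> complex" where "conjugate_complex = cnj"

instance
proof
  fix x :: complex
  show "conjugate x * x = (norm x)\<^sup>2 *\<^sub>R 1"
    unfolding cmod_power2
    by (simp add: conjugate_complex_def complex_eq_iff power2_eq_square)
qed (simp_all add: conjugate_complex_def)

end

instantiation quat :: conj_div_algebra
begin

definition conjugate_quat :: "quat \<Rightarrow> quat" where
  "conjugate_quat x = Quat (qRe x) (- qI x) (- qJ x) (- qK x)"

instance
proof
  fix x :: quat
  show "conjugate x * x = (norm x)\<^sup>2 *\<^sub>R 1"
    unfolding norm_quat_power2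
    by (simp add: conjugate_quat_def quat_eq_iff times_quat_def one_quat_def power2_eq_square)
qed (simp_all add: conjugate_quat_def quat_eq_iff times_quat_def algebra_simps)

end


section \<open>Isotropic measures\<close>

definition hprod :: "'k::conj_div_algebra ^ 'n \<Rightarrow> 'k ^ 'n \<Rightarrow> 'k" where
  "hprod x y = (\<Sum>i\<in>UNIV. conjugate (x $ i) * y $ i)"

lemma hprod_self: "hprod x x = (norm x)\<^sup>2 *\<^sub>R 1"
  by (simp add: hprod_def conjugate_mult_self norm_vec_def L2_set_def sum_nonneg
      scaleR_sum_left)

text \<open>The matrix \<open>x x\<^sup>*\<close>.\<close>

definition outer :: "'k::conj_div_algebra ^ 'n \<Rightarrow> 'k ^ 'n ^ 'n" where
  "outer x = (\<chi> i j. x $ i * conjugate (x $ j))"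

definition isotropic_measure :: "('k::conj_div_algebra ^ 'n) measure \<Rightarrow> bool" where
  "isotropic_measure \<mu> \<longleftrightarrow>
     prob_space \<mu> \<and> sets \<mu> = sets borel \<and>
     has_bochner_integral \<mu> outer ((1 / real CARD('n)) *\<^sub>R mat 1)"

definition moment :: "real \<Rightarrow> ('k::conj_div_algebra ^ 'n) measure \<Rightarrow> real" where
  "moment q \<mu> = (\<integral>x. (\<integral>y. norm (hprod x y) powr q \<partial>\<mu>) \<partial>\<mu>)"


section \<open>Projective space and simplices\<close>

text \<open>
  A point of projective space is the set of all its nonzero representatives; scalars act
  on the right.
\<close>

definition proj_point :: "'k::conj_div_algebra ^ 'n \<Rightarrow> ('k ^ 'n) set" where
  "proj_point x = {(\<chi> i. x $ i * e) |e. e \<noteq> 0}"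

definition projective_space :: "('k::conj_div_algebra ^ 'n) set set" where
  "projective_space = proj_point ` (UNIV - {0})"

text \<open>The Borel sigma-algebra of the quotient topology on projective space.\<close>

definition projective_borel :: "('k::conj_div_algebra ^ 'n) set measure" where
  "projective_borel = sigma projective_space {U. U \<subseteq> projective_space \<and> open (\<Union>U)}"

definition regular_simplex :: "('k::conj_div_algebra ^ 'n) set set \<Rightarrow> bool" where
  "regular_simplex S \<longleftrightarrow>
     finite S \<and> S \<subseteq> projective_space \<and>
     (\<exists>c. \<forall>p\<in>S. \<forall>q\<in>S. p \<noteq> q \<longrightarrow>
        (\<forall>x\<in>p. \<forall>y\<in>q. norm x = 1 \<longrightarrow> norm y = 1 \<longrightarrow> norm (hprod x y) = c))"

text \<open>
  In the next two definitions \<open>k\<close> stands for the real dimension of the scalars and \<open>d\<close>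
  for the number of coordinates. The division is exact.
\<close>

definition max_simplex_size :: "nat \<Rightarrow> nat \<Rightarrow> nat" where
  "max_simplex_size k d = d + (d\<^sup>2 - d) div 2 * k"

definition simplex_beta :: "nat \<Rightarrow> nat \<Rightarrow> real" where
  "simplex_beta k d = sqrt (1 / (real d + 2 / real k))"

definition maximal_simplex :: "('k::conj_div_algebra ^ 'n) set set \<Rightarrow> bool" where
  "maximal_simplex S \<longleftrightarrow>
     regular_simplex S \<and> card S = max_simplex_size DIM('k) CARD('n)"

text \<open>
  The origin, which has no image in projective space, is removed before pushing
  \<open>\<mu>\<close> forward; it is a null set by the first conjunct.
\<close>

definition uniform_over ::
    "('k::conj_div_algebra ^ 'n) measure \<Rightarrow> ('k ^ 'n) set set \<Rightarrow> bool" where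
  "uniform_over \<mu> S \<longleftrightarrow>
     (AE x in \<mu>. norm x = 1) \<and>
     distr (restrict_space \<mu> (- {0})) projective_borel proj_point =
     distr (uniform_count_measure S) projective_borel (\<lambda>p. p)"

end

theory Submission
  imports Defs
begin

text \<open>
  Write \<open>d\<close> for the number of coordinates, \<open>k\<close> for the real dimension of the scalars, and
  \<open>s = |\<langle>x,y\<rangle>|\<^sup>2 / (|x|\<^sup>2 |y|\<^sup>2)\<close>. On the unit interval \<open>s powr (q/2)\<close> lies below the quadratic
  that touches it at \<open>\<beta>\<^sup>2\<close> and meets it at \<open>1\<close>. That quadratic is the target value plus a multiple
  of \<open>s - 1/d\<close> minus a nonnegative multiple of \<open>(s - 1/d)\<^sup>2 - (1 - 1/d)\<^sup>2 / (M - 1)\<close>, and the last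
  kernel is positive semidefinite because the Hermitian matrices have real dimension \<open>M\<close>.
  Integrating against \<open>|x|\<^sup>q |y|\<^sup>q\<close> leaves the term of \<open>s - 1/d\<close>, which is the squared norm of the
  mean of \<open>|x|\<^sup>q (x x\<^sup>* / |x|\<^sup>2 - 1/d)\<close>. It vanishes for measures on the unit sphere, and in general
  isotropy bounds it by the variance of \<open>|x|\<close> to the power \<open>q - 2\<close> under the probability measure
  \<open>|x|\<^sup>2 \<mu>\<close>; for \<open>q \<ge> 1\<close> this is outweighed by the loss in the total mass \<open>\<integral> |x|\<^sup>q \<le> 1\<close>.
  In the case of equality almost all \<open>x\<close> are unit vectors and \<open>|\<langle>x,y\<rangle>| \<in> {\<beta>, 1}\<close> almost surely, so
  isotropy forces every projective class to have mass exactly \<open>1/M\<close>.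
\<close>

section \<open>Quadratic majorants of powers\<close>

text \<open>Weighted AM-GM of \<open>z\<close> and 1: a concave power lies below its tangent at 1.
  It is applied below to \<open>(norm x)\<^sup>2\<close>, to \<open>norm x powr q\<close> and to
  \<open>1 / B\<close>.\<close>

lemma powr_le_affine:
  fixes z \<theta> :: real
  assumes "0 \<le> z" "0 \<le> \<theta>" "\<theta> \<le> 1"
  shows "z powr \<theta> \<le> \<theta> * z + (1 - \<theta>)"
proof (cases "z = 0")
  case False
  then show ?thesis using Youngs_inequality_0[of \<theta> "1 - \<theta>" z 1] assms by simp
qed (use assms in simp)

text \<open>Strictness comes from squaring the weak bound at \<open>u = sqrt z\<close>: the square
  of the affine function of \<open>u\<close> falls short of the affine function of
  \<open>u\<^sup>2\<close> by \<open>\<theta> * (1 - \<theta>) * (u - 1)\<^sup>2\<close>.\<close>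

lemma powr_less_affine:
  fixes z \<theta> :: real
  assumes "0 \<le> z" "0 < \<theta>" "\<theta> < 1" "z \<noteq> 1"
  shows "z powr \<theta> < \<theta> * z + (1 - \<theta>)"
proof -
  define u where "u = sqrt z"
  have u: "0 \<le> u" "z = u\<^sup>2" "u \<noteq> 1" using assms by (auto simp: u_def)
  have "z powr \<theta> = (u powr \<theta>)\<^sup>2"
    using u by (cases "u = 0") (auto simp: power2_eq_square powr_mult)
  also have "\<dots> \<le> (\<theta> * u + (1 - \<theta>))\<^sup>2"
    using powr_le_affine[of u \<theta>] u assms by (intro power_mono) auto
  also have "\<dots> = \<theta> * z + (1 - \<theta>) - \<theta> * (1 - \<theta>) * (u - 1)\<^sup>2"
    by (simp add: u power2_eq_square algebra_simps)
  also have "\<dots> < \<theta> * z + (1 - \<theta>)" using u assms by simp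
  finally show ?thesis .
qed

text \<open>The derivative is demanded at positive points only, so the left end may be 0, where a
  power with exponent below 1 is merely continuous.\<close>

lemma Rolle_pos:
  fixes f f' :: "real \<Rightarrow> real"
  assumes "0 \<le> a" "a < b" "f a = f b" "continuous_on {a..b} f"
    and "\<And>x. 0 < x \<Longrightarrow> (f has_real_derivative f' x) (at x)"
  obtains z where "a < z" "z < b" "f' z = 0"
proof -
  have "\<exists>z. a < z \<and> z < b \<and> DERIV f z :> 0"
    using assms by (intro Rolle) (auto simp: real_differentiable_def intro: le_less_trans)
  then show ?thesis using assms that by (meson DERIV_unique order_le_less_trans)
qed

text \<open>By Rolle, a further zero of the difference would give two zeros of a strictly decreasing
  second derivative.\<close>

lemma powr_less_quadratic:
  fixes B \<alpha> c s :: real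
  assumes B: "0 < B" "B < 1" and \<alpha>: "0 < \<alpha>" "\<alpha> < 1" and s: "0 \<le> s" "s < 1" "s \<noteq> B"
    and c: "B powr \<alpha> + \<alpha> * B powr (\<alpha> - 1) * (1 - B) - c * (1 - B)\<^sup>2 = 1"
  shows "s powr \<alpha> < B powr \<alpha> + \<alpha> * B powr (\<alpha> - 1) * (s - B) - c * (s - B)\<^sup>2"
proof (rule ccontr)
  define D where "D t = B powr \<alpha> + \<alpha> * B powr (\<alpha> - 1) * (t - B) - c * (t - B)\<^sup>2 - t powr \<alpha>" for t
  assume "\<not> ?thesis"
  then have Ds: "D s \<le> 0" by (simp add: D_def)
  \<comment> \<open>Subtracting this multiple of \<open>(t - B)\<^sup>2 * (t - 1)\<close> adds the
    zero \<open>s\<close> and keeps the double zero \<open>B\<close> and the zero 1. The assumed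
    violation \<open>D s \<le> 0\<close> makes it nonnegative.\<close>
  define l where "l = D s / ((s - B)\<^sup>2 * (s - 1))"
  have l: "0 \<le> l" unfolding l_def
    using Ds s by (intro divide_nonpos_nonpos) (auto intro: mult_nonneg_nonpos)
  define f where "f t = D t - l * ((t - B)\<^sup>2 * (t - 1))" for t
  define f' where "f' t = \<alpha> * B powr (\<alpha> - 1) - 2 * c * (t - B) - \<alpha> * t powr (\<alpha> - 1)
      - l * (2 * (t - B) * (t - 1) + (t - B)\<^sup>2)" for t
  define f'' where "f'' t = - 2 * c - \<alpha> * (\<alpha> - 1) * t powr (\<alpha> - 2) - l * (6 * t - 2 - 4 * B)" for t
  have d1: "(f has_real_derivative f' t) (at t)" if "0 < t" for t
    unfolding f_def D_def f'_def using that
    by (auto intro!: derivative_eq_intros simp: power2_eq_square)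
  have d2: "(f' has_real_derivative f'' t) (at t)" if "0 < t" for t
    unfolding f'_def f''_def using that
    by (auto intro!: derivative_eq_intros simp: power2_eq_square)
  have cont: "continuous_on {a..b} f" if "0 \<le> a" for a b
    unfolding f_def D_def using that \<alpha> by (intro continuous_intros continuous_on_powr') auto
  have cont': "continuous_on {a..b} f'" if "0 < a" for a b
    using that by (intro DERIV_continuous_on[where D = f'']) (auto intro!: has_field_derivative_at_within[OF d2])
  have zB: "f B = 0" by (simp add: f_def D_def)
  have z1: "f 1 = 0" using c by (simp add: f_def D_def)
  have zs: "f s = 0" using s by (simp add: f_def l_def)
  have z'B: "f' B = 0" by (simp add: f'_def)
  \<comment> \<open>The derivative vanishes at the double zero \<open>B\<close> and once in each gap
    between neighbours among \<open>s\<close>, \<open>B\<close> and 1.\<close>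
  have "\<exists>a b e. 0 < a \<and> a < b \<and> b < e \<and> f' a = 0 \<and> f' b = 0 \<and> f' e = 0"
  proof (cases "s < B")
    case True
    obtain x where "s < x" "x < B" "f' x = 0"
      using Rolle_pos[OF s(1) True _ cont[OF s(1)] d1] zs zB by auto
    moreover obtain y where "B < y" "y < 1" "f' y = 0"
      using Rolle_pos[OF _ B(2) _ cont d1] B zB z1 by auto
    ultimately show ?thesis using z'B s by (intro exI[of _ x] exI[of _ B] exI[of _ y]) auto
  next
    case False
    then have "B < s" using s by simp
    obtain x where "B < x" "x < s" "f' x = 0"
      using Rolle_pos[OF _ \<open>B < s\<close> _ cont d1] B zB zs by auto
    moreover obtain y where "s < y" "y < 1" "f' y = 0"
      using Rolle_pos[OF s(1) s(2) _ cont[OF s(1)] d1] zs z1 by auto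
    ultimately show ?thesis using z'B B by (intro exI[of _ B] exI[of _ x] exI[of _ y]) auto
  qed
  then obtain a b e where abe: "0 < a" "a < b" "b < e" "f' a = 0" "f' b = 0" "f' e = 0" by blast
  obtain u where u: "a < u" "u < b" "f'' u = 0"
    using Rolle_pos[OF _ abe(2) _ cont'[OF abe(1)] d2] abe by auto
  obtain v where v: "b < v" "v < e" "f'' v = 0"
    using Rolle_pos[OF _ abe(3) _ cont' d2] abe by auto
  \<comment> \<open>In \<open>f''\<close> the power has positive coefficient
    \<open>\<alpha> * (1 - \<alpha>)\<close> and negative exponent, and the linear term has slope
    \<open>- 6 * l\<close>.\<close>
  have "0 < u" "u < v" using u v abe by auto
  then have "v powr (\<alpha> - 2) < u powr (\<alpha> - 2)" using \<alpha> by (intro powr_less_mono2_neg) auto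
  then have "\<alpha> * (1 - \<alpha>) * v powr (\<alpha> - 2) < \<alpha> * (1 - \<alpha>) * u powr (\<alpha> - 2)"
    using \<alpha> by simp
  moreover have "l * u \<le> l * v" using l \<open>u < v\<close> by (intro mult_left_mono) auto
  ultimately show False using u(3) v(3) by (simp add: f''_def algebra_simps)
qed

text \<open>By its equation, \<open>c * (1 - B)\<^sup>2\<close> is the height at 1 of the tangent at
  \<open>B\<close> above the power, which concavity makes nonnegative. Scaled by \<open>B\<close>,
  this is AM-GM at \<open>1 / B\<close>.\<close>

lemma quadratic_coeff_nonneg:
  fixes B \<alpha> c :: real
  assumes B: "0 < B" "B < 1" and \<alpha>: "0 \<le> \<alpha>" "\<alpha> \<le> 1"
    and c: "B powr \<alpha> + \<alpha> * B powr (\<alpha> - 1) * (1 - B) - c * (1 - B)\<^sup>2 = 1"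
  shows "0 \<le> c"
proof -
  have "(1 / B) powr \<alpha> \<le> \<alpha> * (1 / B) + (1 - \<alpha>)"
    using B \<alpha> by (intro powr_le_affine) auto
  then have "B powr \<alpha> * (1 / B) powr \<alpha> \<le> B powr \<alpha> * (\<alpha> * (1 / B) + (1 - \<alpha>))"
    by (rule mult_left_mono) simp
  moreover have "B powr \<alpha> * (1 / B) powr \<alpha> = 1"
    using B by (simp add: powr_divide)
  ultimately have 1: "1 \<le> B powr \<alpha> * (\<alpha> * (1 / B) + (1 - \<alpha>))" by simp
  define p where "p = B powr (\<alpha> - 1)"
  have b: "B powr \<alpha> = p * B" using B by (simp add: p_def powr_diff)
  have "c * (1 - B)\<^sup>2 = p * B + \<alpha> * p * (1 - B) - 1"
    using c unfolding b p_def[symmetric] by linarith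
  also have "\<dots> = p * B * (\<alpha> * (1 / B) + (1 - \<alpha>)) - 1" using B by (simp add: field_simps)
  finally have "0 \<le> c * (1 - B)\<^sup>2" using 1 unfolding b by linarith
  then show ?thesis using B by (simp add: zero_le_mult_iff)
qed

text \<open>Equality holds at the contact points \<open>B\<close> and 1; for
  \<open>\<alpha> = 1\<close> the equation forces \<open>c = 0\<close> and the quadratic is
  \<open>s\<close> itself. All other cases are strict.\<close>

lemma powr_le_quadratic:
  fixes B \<alpha> c s :: real
  assumes B: "0 < B" "B < 1" and \<alpha>: "0 < \<alpha>" "\<alpha> \<le> 1" and s: "0 \<le> s" "s \<le> 1"
    and c: "B powr \<alpha> + \<alpha> * B powr (\<alpha> - 1) * (1 - B) - c * (1 - B)\<^sup>2 = 1"
  shows "s powr \<alpha> \<le> B powr \<alpha> + \<alpha> * B powr (\<alpha> - 1) * (s - B) - c * (s - B)\<^sup>2"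
proof (cases "\<alpha> = 1 \<or> s = B \<or> s = 1")
  case True
  then show ?thesis
  proof (elim disjE)
    assume "\<alpha> = 1"
    with c B have "c = 0" by simp
    then show ?thesis using \<open>\<alpha> = 1\<close> B s by simp
  qed (use c in simp_all)
next
  case False
  then show ?thesis using powr_less_quadratic[of B \<alpha> s c] assms by simp
qed

text \<open>Condition \<open>eB\<close> says that \<open>e\<close> is the mean of the law with mass
  \<open>1 / M\<close> at 1 and the rest at \<open>B\<close>, the law of \<open>s\<close> for a
  maximal simplex. After expansion about \<open>e\<close>, the constants are the mean of the
  quadratic and the variance \<open>(1 - e)\<^sup>2 / (M - 1)\<close> under this law.\<close>

lemma quadratic_average:
  fixes B b K c M e s :: real
  assumes "B < 1" "0 < M" and eB: "(M - 1) * (e - B) = 1 - e" and c: "b + K * (1 - B) - c * (1 - B)\<^sup>2 = 1"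
  shows "b + K * (s - B) - c * (s - B)\<^sup>2 = (b + (1 - b) / M) + (K - 2 * c * (e - B)) * (s - e)
     - c * ((s - e)\<^sup>2 - (1 - e)\<^sup>2 / (M - 1))"
proof -
  have 1: "(1 - e)\<^sup>2 / (M - 1) = (1 - e) * (e - B)"
  \<comment> \<open>For \<open>M = 1\<close>, which is dimension one, \<open>eB\<close> gives
    \<open>e = 1\<close>, and the quotient by zero is 0.\<close>
  proof (cases "M = 1")
    case False
    have "(1 - e)\<^sup>2 = (1 - e) * (e - B) * (M - 1)"
      by (simp add: power2_eq_square flip: eB)
    then show ?thesis using False by simp
  qed (use eB in simp)
  have "M * (e - B) = 1 - B" using eB by (simp add: algebra_simps)
  then have "1 / M = (e - B) / (1 - B)" using assms(1,2) by (simp add: field_simps)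
  then have "(1 - b) / M = (1 - b) * ((e - B) / (1 - B))"
    by (metis mult.right_neutral times_divide_eq_right)
  also have "\<dots> = (K - c * (1 - B)) * (1 - B) * ((e - B) / (1 - B))"
    using c by (intro arg_cong2[where f = "(*)"] refl) (simp add: power2_eq_square algebra_simps)
  finally have 2: "(1 - b) / M = (K - c * (1 - B)) * (e - B)" using assms(1) by simp
  show ?thesis unfolding 1 2 by (simp add: power2_eq_square algebra_simps)
qed

section \<open>The number M and its relation to \<beta>\<close>

lemma max_simplex_size_real:
  "real (max_simplex_size k d) = real d + (real d ^ 2 - real d) / 2 * real k"
proof -
  have "2 dvd d\<^sup>2 - d" by (simp add: power2_eq_square)
  then have "real ((d\<^sup>2 - d) div 2) = real (d\<^sup>2 - d) / 2" by (simp add: real_of_nat_div)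
  also have "real (d\<^sup>2 - d) = real d ^ 2 - real d"
    by (subst of_nat_diff) (simp_all add: power2_eq_square)
  finally show ?thesis by (simp add: max_simplex_size_def)
qed

text \<open>The first identity is the condition \<open>eB\<close> of
  \<open>quadratic_average\<close> at \<open>e = 1 / d\<close>; it ties \<beta> to M. In terms of
  \<open>Y\<close> its factors are \<open>(d - 1) * Y / 2\<close> and
  \<open>2 / (d * Y)\<close>.\<close>

lemma simplex_size_identity:
  fixes k d :: nat
  assumes "0 < k" "0 < d"
  defines "M \<equiv> real (max_simplex_size k d)" and "B \<equiv> 1 / (real d + 2 / real k)"
  shows "(M - 1) * (1 / real d - B) = 1 - 1 / real d" "1 \<le> M" "0 < B" "B < 1" "B \<le> 1 / real d"
proof -
  have M: "M = real d + (real d ^ 2 - real d) / 2 * real k"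
    unfolding M_def by (rule max_simplex_size_real)
  have d: "1 \<le> real d" and k: "0 < real k" using assms by auto
  have "0 < 2 / real k" using k by simp
  then have p: "0 < real d + 2 / real k" "1 < real d + 2 / real k" using d by linarith+
  show "B \<le> 1 / real d" "0 < B" "B < 1" unfolding B_def using p d k
    by (auto intro!: divide_left_mono)
  have "real d \<le> real d ^ 2" using d by (simp add: power2_eq_square)
  then show "1 \<le> M" unfolding M using d k by (simp add: add_increasing2)
  define Y where "Y = real d * real k + 2"
  have Y: "Y > 0" unfolding Y_def using d k by (simp add: add_pos_pos)
  have 1: "1 / real d - B = 2 / (real d * Y)"
    unfolding B_def Y_def using d k p by (simp add: field_simps)
  have 2: "M - 1 = (real d - 1) * Y / 2"
    unfolding M Y_def by (simp add: field_simps power2_eq_square)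
  show "(M - 1) * (1 / real d - B) = 1 - 1 / real d"
    unfolding 1 2 using d Y by (simp add: field_simps)
qed

section \<open>Conjugation and rank-one matrices\<close>

lemma conjugate_one [simp]: "conjugate (1::'k::conj_div_algebra) = 1"
  using conjugate_mult_self[of "1::'k"] by simp

lemma conjugate_zero [simp]: "conjugate (0::'k::conj_div_algebra) = 0"
  using conjugate_scaleR[of 0 "0::'k"] by simp

lemma linear_conjugate: "linear (conjugate :: 'k::conj_div_algebra \<Rightarrow> 'k)"
  by (intro linearI conjugate_add conjugate_scaleR)

text \<open>Polarization of \<open>conjugate_mult_self\<close>; it expresses the real inner product
  through the multiplication.\<close>

lemma conjugate_mult_add:
  fixes x y :: "'k::conj_div_algebra"
  shows "conjugate x * y + conjugate y * x = (2 * (x \<bullet> y)) *\<^sub>R 1"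
proof -
  have "conjugate (x + y) * (x + y) = (norm (x + y))\<^sup>2 *\<^sub>R 1"
    by (rule conjugate_mult_self)
  moreover have "(norm (x + y))\<^sup>2 = (norm x)\<^sup>2 + 2 * (x \<bullet> y) + (norm y)\<^sup>2"
    by (simp add: power2_norm_eq_inner inner_simps inner_commute)
  ultimately have "conjugate x * x + (conjugate x * y + conjugate y * x) + conjugate y * y
      = (norm x)\<^sup>2 *\<^sub>R 1 + (2 * (x \<bullet> y)) *\<^sub>R 1 + (norm y)\<^sup>2 *\<^sub>R (1::'k)"
    by (simp add: conjugate_add algebra_simps scaleR_left_distrib)
  then show ?thesis by (simp add: conjugate_mult_self)
qed

text \<open>Polarization against 1: conjugation is the reflection that fixes the real line. In
  particular \<open>x\<close> commutes with its conjugate.\<close>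

lemma conjugate_eq:
  fixes x :: "'k::conj_div_algebra"
  shows "conjugate x = (2 * (1 \<bullet> x)) *\<^sub>R 1 - x"
  using conjugate_mult_add[of 1 x] by (simp add: algebra_simps)

lemma mult_conjugate_self: "x * conjugate x = (norm x)\<^sup>2 *\<^sub>R (1::'k::conj_div_algebra)"
proof -
  have "x * conjugate x = conjugate x * x"
    by (simp add: conjugate_eq algebra_simps)
  then show ?thesis by (simp add: conjugate_mult_self)
qed

lemma norm_conjugate [simp]: "norm (conjugate x) = norm (x::'k::conj_div_algebra)"
proof -
  have "(norm (conjugate x))\<^sup>2 *\<^sub>R (1::'k) = (norm x)\<^sup>2 *\<^sub>R 1"
    using conjugate_mult_self[of "conjugate x"] by (simp add: conjugate_conjugate mult_conjugate_self)
  then have "(norm (conjugate x))\<^sup>2 = (norm x)\<^sup>2" by simp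
  then show ?thesis by simp
qed

lemma inner_conjugate_both: "conjugate x \<bullet> conjugate y = x \<bullet> (y::'k::conj_div_algebra)"
proof -
  have "norm (conjugate x + conjugate y) = norm (x + y)"
    by (simp flip: conjugate_add)
  then show ?thesis
    using dot_norm[of "conjugate x" "conjugate y"] dot_norm[of x y] by simp
qed

lemma inner_conjugate_right: "x \<bullet> conjugate y = conjugate x \<bullet> (y::'k::conj_div_algebra)"
  using inner_conjugate_both[of x "conjugate y"] by (simp add: conjugate_conjugate)

text \<open>Polarization turns both sides into the same sum of products up to associativity.
  Together with the rule for right factors, this moves factors around without commutativity.\<close>

lemma inner_mult_left_eq: "(a * b) \<bullet> c = b \<bullet> (conjugate a * (c::'k::conj_div_algebra))"
proof -
  have "(2 * ((a * b) \<bullet> c)) *\<^sub>R (1::'k) = (2 * (b \<bullet> (conjugate a * c))) *\<^sub>R 1"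
    unfolding conjugate_mult_add[symmetric] by (simp add: conjugate_mult conjugate_conjugate mult.assoc)
  then show ?thesis by simp
qed

lemma inner_mult_right_eq: "(a * b) \<bullet> c = a \<bullet> (c * conjugate (b::'k::conj_div_algebra))"
proof -
  have "(a * b) \<bullet> c = (conjugate b * conjugate a) \<bullet> conjugate c"
    by (simp add: inner_conjugate_both flip: conjugate_mult)
  also have "\<dots> = conjugate a \<bullet> conjugate (c * conjugate b)"
    by (simp add: inner_mult_left_eq conjugate_mult conjugate_conjugate)
  finally show ?thesis by (simp add: inner_conjugate_both)
qed

text \<open>This is the trace of conjugation, which is 1 on the reals and -1 on their orthogonal
  complement.\<close>

lemma sum_Basis_inner_conjugate:
  "(\<Sum>b\<in>(Basis::'k::conj_div_algebra set). b \<bullet> conjugate b) = 2 - real DIM('k)"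
proof -
  have "(\<Sum>b\<in>(Basis::'k set). b \<bullet> conjugate b) = (\<Sum>b\<in>(Basis::'k set). 2 * ((1 \<bullet> b) * (1 \<bullet> b)) - 1)"
    by (intro sum.cong refl)
      (simp add: conjugate_eq inner_diff_right inner_same_Basis inner_commute)
  also have "\<dots> = 2 * ((1::'k) \<bullet> 1) - real DIM('k)"
    by (simp add: sum_subtractf flip: sum_distrib_left) (metis euclidean_inner)
  finally show ?thesis by (simp flip: power2_norm_eq_inner)
qed

text \<open>Turns the squared modulus into a pairing linear in each rank-one matrix, which isotropy
  can integrate. The two adjointness rules separate the indices \<open>i\<close> and
  \<open>j\<close> in each term, and the double sum then factors.\<close>

lemma inner_outer: "outer x \<bullet> outer y = (norm (hprod x (y::'k::conj_div_algebra ^ 'n)))\<^sup>2"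
proof -
  have "(x $ i * conjugate (x $ j)) \<bullet> (y $ i * conjugate (y $ j))
      = (conjugate (x $ i) * y $ i) \<bullet> (conjugate (x $ j) * y $ j)" for i j
  proof -
    have "(x $ i * conjugate (x $ j)) \<bullet> (y $ i * conjugate (y $ j))
        = conjugate (x $ j) \<bullet> (conjugate (x $ i) * y $ i * conjugate (y $ j))"
      by (simp only: inner_mult_left_eq mult.assoc)
    also have "\<dots> = (conjugate (x $ j) * y $ j) \<bullet> (conjugate (x $ i) * y $ i)"
      by (simp only: inner_mult_right_eq)
    finally show ?thesis by (simp only: inner_commute)
  qed
  then have "outer x \<bullet> outer y = (\<Sum>i\<in>UNIV. \<Sum>j\<in>UNIV.
      (conjugate (x $ i) * y $ i) \<bullet> (conjugate (x $ j) * y $ j))"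
    unfolding inner_vec_def outer_def vec_lambda_beta by (intro sum.cong refl)
  also have "\<dots> = hprod x y \<bullet> hprod x y"
    unfolding hprod_def inner_sum_left inner_sum_right by (rule sum.swap)
  finally show ?thesis by (simp add: power2_norm_eq_inner[symmetric])
qed

lemma norm_outer: "norm (outer x) = (norm (x::'k::conj_div_algebra ^ 'n))\<^sup>2"
proof -
  have "(norm (outer x))\<^sup>2 = ((norm x)\<^sup>2)\<^sup>2"
    unfolding power2_norm_eq_inner[of "outer x"] inner_outer hprod_self by simp
  then show ?thesis by (rule power2_eq_imp_eq) simp_all
qed

lemma norm_hprod_le: "norm (hprod x y) \<le> norm x * norm (y::'k::conj_div_algebra ^ 'n)"
proof -
  have "(norm (hprod x y))\<^sup>2 \<le> (norm x * norm y)\<^sup>2"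
    using norm_cauchy_schwarz[of "outer x" "outer y"]
    by (simp add: inner_outer norm_outer power_mult_distrib)
  then show ?thesis by (rule power2_le_imp_le) simp
qed

section \<open>Adjoints and traces of matrices\<close>

definition adjoint_mat :: "'k::conj_div_algebra ^ 'n ^ 'n \<Rightarrow> 'k ^ 'n ^ 'n" where
  "adjoint_mat X = (\<chi> i j. conjugate (X $ j $ i))"

lemma adjoint_outer: "adjoint_mat (outer x) = outer x"
  by (simp add: adjoint_mat_def outer_def vec_eq_iff conjugate_mult conjugate_conjugate)

lemma adjoint_one: "adjoint_mat (mat 1) = mat 1"
  by (simp add: adjoint_mat_def mat_def vec_eq_iff)

lemma adjoint_add: "adjoint_mat (X + Y) = adjoint_mat X + adjoint_mat Y"
  by (simp add: adjoint_mat_def vec_eq_iff conjugate_add)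

lemma adjoint_diff: "adjoint_mat (X - Y) = adjoint_mat X - adjoint_mat Y"
  by (simp add: adjoint_mat_def vec_eq_iff linear_diff[OF linear_conjugate])

lemma adjoint_scaleR: "adjoint_mat (r *\<^sub>R X) = r *\<^sub>R adjoint_mat X"
  by (simp add: adjoint_mat_def vec_eq_iff conjugate_scaleR)

lemma inner_adjoint: "X \<bullet> adjoint_mat Y = adjoint_mat X \<bullet> Y"
  unfolding inner_vec_def adjoint_mat_def
  by (simp add: inner_conjugate_right) (rule sum.swap)

lemma adjoint_adjoint: "adjoint_mat (adjoint_mat X) = X"
  by (simp add: adjoint_mat_def vec_eq_iff conjugate_conjugate)

lemma inner_mat1_mat1: "(mat 1 :: 'k::conj_div_algebra ^ 'n ^ 'n) \<bullet> mat 1 = real CARD('n)"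
proof -
  have "(1::'k) \<bullet> 1 = 1" by (simp flip: power2_norm_eq_inner)
  then show ?thesis
  by (simp add: inner_vec_def mat_def if_distrib[of "\<lambda>x. x \<bullet> _"] if_distrib[of "\<lambda>x. _ \<bullet> x"] cong: if_cong)
qed

lemma inner_mat1_outer: "mat 1 \<bullet> outer x = (norm (x::'k::conj_div_algebra ^ 'n))\<^sup>2"
proof -
  have "(1::'k) \<bullet> 1 = 1" by (simp flip: power2_norm_eq_inner)
  then show ?thesis
    by (simp add: inner_vec_def mat_def outer_def if_distrib[of "\<lambda>x. x \<bullet> _"] mult_conjugate_self
      norm_vec_def L2_set_def sum_nonneg cong: if_cong)
qed

lemma sum_Basis_vec:
  "(\<Sum>e\<in>(Basis::('a::euclidean_space ^ 'n) set). f e) = (\<Sum>i\<in>UNIV. \<Sum>b\<in>Basis. f (axis i b))"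
proof -
  have "(\<Sum>e\<in>(Basis::('a ^ 'n) set). f e) = (\<Sum>i\<in>UNIV. \<Sum>e\<in>axis i ` Basis. f e)"
    unfolding Basis_vec_def
    by (subst sum.UNION_disjoint[symmetric])
      (auto simp: axis_eq_axis nonzero_Basis intro!: sum.cong)
  then show ?thesis
    by (simp add: sum.reindex inj_on_def axis_eq_axis)
qed

text \<open>The trace of the adjoint map: it moves every off-diagonal position and acts by
  conjugation on each diagonal entry.\<close>

lemma sum_Basis_inner_adjoint:
  "(\<Sum>e\<in>(Basis::('k::conj_div_algebra ^ 'n ^ 'n) set). e \<bullet> adjoint_mat e)
    = real CARD('n) * (2 - real DIM('k))"
proof -
  have "axis i (axis j b) \<bullet> adjoint_mat (axis i (axis j b)) = (if i = j then b \<bullet> conjugate b else 0)"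
    for i j :: 'n and b :: 'k
    by (simp add: inner_axis' adjoint_mat_def) (simp add: axis_def)
  then have "(\<Sum>e\<in>(Basis::('k ^ 'n ^ 'n) set). e \<bullet> adjoint_mat e)
      = (\<Sum>i::'n\<in>UNIV. \<Sum>j\<in>UNIV. if i = j then \<Sum>b\<in>Basis. (b::'k) \<bullet> conjugate b else 0)"
    unfolding sum_Basis_vec by (intro sum.cong refl) simp
  then show ?thesis by (simp add: sum_Basis_inner_conjugate)
qed

section \<open>The traceless Hermitian kernel\<close>

text \<open>The orthogonal projection onto the traceless Hermitian matrices; pairing with
  \<open>mat 1\<close> is the real part of the trace.\<close>

definition herm0 :: "'k::conj_div_algebra ^ 'n ^ 'n \<Rightarrow> 'k ^ 'n ^ 'n" where
  "herm0 X = (1 / 2) *\<^sub>R (X + adjoint_mat X) - ((mat 1 \<bullet> X) / real CARD('n)) *\<^sub>R mat 1"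

lemma inner_mat1_adjoint: "mat 1 \<bullet> adjoint_mat X = mat 1 \<bullet> (X :: 'k::conj_div_algebra ^ 'n ^ 'n)"
  by (simp add: inner_adjoint adjoint_one)

lemma inner_herm0_left: "herm0 X \<bullet> Y = X \<bullet> herm0 (Y :: 'k::conj_div_algebra ^ 'n ^ 'n)"
  by (simp add: herm0_def inner_simps inner_adjoint inner_commute[of X "mat 1"])

lemma herm0_fixed:
  fixes X :: "'k::conj_div_algebra ^ 'n ^ 'n"
  assumes "adjoint_mat X = X" "mat 1 \<bullet> X = 0"
  shows "herm0 X = X"
  using assms by (simp add: herm0_def flip: scaleR_2)

lemma herm0_idem: "herm0 (herm0 X) = herm0 (X :: 'k::conj_div_algebra ^ 'n ^ 'n)"
proof (rule herm0_fixed)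
  show "adjoint_mat (herm0 X) = herm0 X"
    by (simp add: herm0_def adjoint_diff adjoint_scaleR adjoint_add adjoint_adjoint adjoint_one add.commute)
  show "mat 1 \<bullet> herm0 X = 0"
    by (simp add: herm0_def inner_simps inner_mat1_adjoint inner_mat1_mat1)
qed

text \<open>The trace of a projection is the dimension of its range, here that of the traceless
  Hermitian matrices. This is how M enters the bound.\<close>

lemma sum_Basis_inner_herm0:
  "(\<Sum>e\<in>(Basis::('k::conj_div_algebra ^ 'n ^ 'n) set). e \<bullet> herm0 e)
    = real (max_simplex_size DIM('k) CARD('n)) - 1"
proof -
  let ?B = "Basis::('k ^ 'n ^ 'n) set" and ?d = "real CARD('n)" and ?k = "real DIM('k)"
  have "(\<Sum>e\<in>?B. e \<bullet> herm0 e)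
      = (\<Sum>e\<in>?B. 1 / 2 + (1 / 2) * (e \<bullet> adjoint_mat e) - (1 / ?d) * ((mat 1 \<bullet> e) * (mat 1 \<bullet> e)))"
    by (intro sum.cong refl)
      (simp add: herm0_def inner_simps inner_same_Basis inner_commute)
  also have "\<dots> = real (card ?B) / 2 + (1 / 2) * (\<Sum>e\<in>?B. e \<bullet> adjoint_mat e)
      - (1 / ?d) * (\<Sum>e\<in>?B. (mat 1 \<bullet> e) * (mat 1 \<bullet> e))"
    by (simp add: sum_subtractf sum.distrib sum_distrib_left)
  also have "(\<Sum>e\<in>?B. (mat 1 \<bullet> e) * (mat 1 \<bullet> e)) = ?d"
    using euclidean_inner[of "mat 1 :: 'k ^ 'n ^ 'n" "mat 1"] by (simp add: inner_mat1_mat1)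
  also have "real (card ?B) = ?d * ?d * ?k" by simp
  finally show ?thesis
    by (simp add: max_simplex_size_real sum_Basis_inner_adjoint field_simps power2_eq_square)
qed

text \<open>The kernel is the Gram kernel of the tensors \<open>X \<otimes> X - c P\<close>, where \<open>P\<close> is the projection onto
  traceless Hermitian matrices and \<open>c\<close> is chosen so that the cross terms become constant.\<close>

lemma traceless_kernel_eq_Gram:
  fixes X Y :: "'k::conj_div_algebra ^ 'n ^ 'n" and t :: real
  defines "c \<equiv> t / (real (max_simplex_size DIM('k) CARD('n)) - 1)"
  assumes X: "adjoint_mat X = X" "mat 1 \<bullet> X = 0" "X \<bullet> X = t"
    and Y: "adjoint_mat Y = Y" "mat 1 \<bullet> Y = 0" "Y \<bullet> Y = t"
  shows "(\<Sum>e\<in>Basis. \<Sum>f\<in>Basis. ((X \<bullet> e) * (X \<bullet> f) - c * (herm0 e \<bullet> f)) *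
      ((Y \<bullet> e) * (Y \<bullet> f) - c * (herm0 e \<bullet> f)))
    = (X \<bullet> Y)\<^sup>2 - t\<^sup>2 / (real (max_simplex_size DIM('k) CARD('n)) - 1)"
proof -
  let ?B = "Basis::('k ^ 'n ^ 'n) set" and ?M = "real (max_simplex_size DIM('k) CARD('n)) - 1"
  \<comment> \<open>Pairing the projection with \<open>Z \<otimes> Z\<close> gives the inner product
    of \<open>herm0 Z = Z\<close> with \<open>Z\<close>.\<close>
  have dual: "(\<Sum>e\<in>?B. \<Sum>f\<in>?B. (herm0 e \<bullet> f) * ((Z \<bullet> e) * (Z \<bullet> f))) = t"
    if "adjoint_mat Z = Z" "mat 1 \<bullet> Z = 0" "Z \<bullet> Z = t" for Z
  proof -
    have "(\<Sum>f\<in>?B. (herm0 e \<bullet> f) * ((Z \<bullet> e) * (Z \<bullet> f))) = (Z \<bullet> e) * (Z \<bullet> e)" for e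
    proof -
      have "(\<Sum>f\<in>?B. (herm0 e \<bullet> f) * ((Z \<bullet> e) * (Z \<bullet> f))) = (Z \<bullet> e) * (\<Sum>f\<in>?B. (herm0 e \<bullet> f) * (Z \<bullet> f))"
        by (simp add: sum_distrib_left mult_ac)
      also have "(\<Sum>f\<in>?B. (herm0 e \<bullet> f) * (Z \<bullet> f)) = herm0 e \<bullet> Z" by (rule euclidean_inner[symmetric])
      finally show ?thesis using inner_herm0_left[of e Z] herm0_fixed[OF that(1,2)] by (simp add: inner_commute)
    qed
    then show ?thesis using that(3) euclidean_inner[of Z Z] by simp
  qed
  \<comment> \<open>The projection is self-adjoint and idempotent, so its squared Hilbert-Schmidt
    norm is its trace.\<close>
  have sq: "(\<Sum>e\<in>?B. \<Sum>f\<in>?B. (herm0 e \<bullet> f) * (herm0 e \<bullet> f)) = ?M"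
    unfolding euclidean_inner[symmetric] by (simp only: inner_herm0_left herm0_idem sum_Basis_inner_herm0)
  have "(\<Sum>e\<in>?B. \<Sum>f\<in>?B. ((X \<bullet> e) * (X \<bullet> f)) * ((Y \<bullet> e) * (Y \<bullet> f)))
      = (\<Sum>e\<in>?B. (X \<bullet> e) * (Y \<bullet> e)) * (\<Sum>f\<in>?B. (X \<bullet> f) * (Y \<bullet> f))"
    by (simp add: sum_product mult_ac)
  then have XY: "(\<Sum>e\<in>?B. \<Sum>f\<in>?B. ((X \<bullet> e) * (X \<bullet> f)) * ((Y \<bullet> e) * (Y \<bullet> f))) = (X \<bullet> Y)\<^sup>2"
    by (simp add: power2_eq_square flip: euclidean_inner)
  have "(\<Sum>e\<in>Basis. \<Sum>f\<in>Basis. ((X \<bullet> e) * (X \<bullet> f) - c * (herm0 e \<bullet> f)) *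
      ((Y \<bullet> e) * (Y \<bullet> f) - c * (herm0 e \<bullet> f)))
    = (\<Sum>e\<in>?B. \<Sum>f\<in>?B. ((X \<bullet> e) * (X \<bullet> f)) * ((Y \<bullet> e) * (Y \<bullet> f))
      - c * ((herm0 e \<bullet> f) * ((X \<bullet> e) * (X \<bullet> f))) - c * ((herm0 e \<bullet> f) * ((Y \<bullet> e) * (Y \<bullet> f)))
      + c\<^sup>2 * ((herm0 e \<bullet> f) * (herm0 e \<bullet> f)))"
    by (intro sum.cong refl) (simp add: algebra_simps power2_eq_square)
  also have "\<dots> = (X \<bullet> Y)\<^sup>2 - c * t - c * t + c\<^sup>2 * ?M"
    by (simp only: sum.distrib sum_subtractf sum_distrib_left[symmetric] XY dual[OF X] dual[OF Y] sq)
  \<comment> \<open>In dimension one \<open>?M = 0\<close>, and \<open>c\<close> and the quotient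
    are both 0 as divisions by zero.\<close>
  also have "\<dots> = (X \<bullet> Y)\<^sup>2 - t\<^sup>2 / ?M"
    by (cases "?M = 0") (simp_all add: c_def power2_eq_square)
  finally show ?thesis .
qed

text \<open>Makes the quadratic form a linear functional of \<open>outer x\<close>, whose mean
  isotropy prescribes; \<open>inner_mat1_adjoint_mult\<close> then evaluates that mean.\<close>

lemma norm_matrix_vector_mult_power2:
  fixes X :: "'k::conj_div_algebra ^ 'n ^ 'n"
  shows "(norm (X *v x))\<^sup>2 = (adjoint_mat X ** X) \<bullet> outer x"
proof -
  have *: "(a * u) \<bullet> (b * v) = (conjugate b * a) \<bullet> (v * conjugate u)" for a b u v :: 'k
  proof -
    have "(a * u) \<bullet> (b * v) = (b * (v * conjugate u)) \<bullet> a"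
      unfolding inner_mult_right_eq[of a u] mult.assoc by (rule inner_commute)
    also have "\<dots> = (v * conjugate u) \<bullet> (conjugate b * a)" by (simp only: inner_mult_left_eq)
    finally show ?thesis by (simp only: inner_commute)
  qed
  have "(norm (X *v x))\<^sup>2 = (\<Sum>i\<in>UNIV. \<Sum>l\<in>UNIV. \<Sum>j\<in>UNIV. (X $ i $ j * x $ j) \<bullet> (X $ i $ l * x $ l))"
    unfolding power2_norm_eq_inner inner_vec_def
    by (simp add: matrix_vector_mult_def inner_sum_left inner_sum_right)
  also have "\<dots> = (\<Sum>l\<in>UNIV. \<Sum>i\<in>UNIV. \<Sum>j\<in>UNIV. (X $ i $ j * x $ j) \<bullet> (X $ i $ l * x $ l))"
    by (rule sum.swap)
  also have "\<dots> = (\<Sum>l\<in>UNIV. \<Sum>j\<in>UNIV. \<Sum>i\<in>UNIV. (X $ i $ j * x $ j) \<bullet> (X $ i $ l * x $ l))"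
    by (intro sum.cong refl sum.swap)
  also have "\<dots> = (\<Sum>l\<in>UNIV. \<Sum>j\<in>UNIV. \<Sum>i\<in>UNIV.
      (conjugate (X $ i $ l) * X $ i $ j) \<bullet> (x $ l * conjugate (x $ j)))"
    by (intro sum.cong refl *)
  also have "\<dots> = (adjoint_mat X ** X) \<bullet> outer x"
    by (simp add: inner_vec_def outer_def matrix_matrix_mult_def adjoint_mat_def inner_sum_left)
  finally show ?thesis .
qed

lemma inner_outer_matrix:
  fixes X :: "'k::conj_div_algebra ^ 'n ^ 'n"
  shows "outer x \<bullet> X = x \<bullet> (X *v x)"
  unfolding inner_vec_def
  by (simp add: outer_def matrix_vector_mult_def inner_sum_right inner_mult_right_eq conjugate_conjugate)

lemma inner_mat1_adjoint_mult:
  fixes X :: "'k::conj_div_algebra ^ 'n ^ 'n"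
  shows "(adjoint_mat X ** X) \<bullet> mat 1 = (norm X)\<^sup>2"
proof -
  have "(conjugate a * a) \<bullet> 1 = a \<bullet> (a::'k)" for a
    by (simp only: inner_mult_left_eq conjugate_conjugate mult.right_neutral)
  then have "(adjoint_mat X ** X) \<bullet> mat 1 = (\<Sum>l\<in>UNIV. \<Sum>i\<in>UNIV. (X $ i $ l) \<bullet> (X $ i $ l))"
    by (simp add: inner_vec_def mat_def matrix_matrix_mult_def adjoint_mat_def inner_sum_left
      if_distrib[of "\<lambda>x. _ \<bullet> x"] cong: if_cong)
  also have "\<dots> = (norm X)\<^sup>2"
    unfolding power2_norm_eq_inner inner_vec_def by (rule sum.swap)
  finally show ?thesis .
qed

section \<open>Unit vectors and the points of projective space\<close>

lemma norm_hprod_commute: "norm (hprod x y) = norm (hprod y (x::'k::conj_div_algebra ^ 'n))"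
proof -
  have "(norm (hprod x y))\<^sup>2 = (norm (hprod y x))\<^sup>2"
    by (metis inner_outer inner_commute)
  then show ?thesis by simp
qed

text \<open>The squared distance of the two rank-one matrices is 1 + 1 - 2 = 0, so they agree. Then
  y = y y* y = x x* y shows \<open>y\<close> as a right multiple of \<open>x\<close>.\<close>

lemma outer_eqD:
  fixes x y :: "'k::conj_div_algebra ^ 'n"
  assumes "norm x = 1" "norm y = 1" "norm (hprod x y) = 1"
  shows "y = (\<chi> i. x $ i * hprod x y)"
proof -
  have "(norm (outer x - outer y))\<^sup>2 = 0"
    unfolding power2_norm_eq_inner[of "outer x - outer y"] inner_diff_left inner_diff_right inner_outer hprod_self
    using assms by (simp add: norm_hprod_commute[of y x])
  then have eq: "outer x = outer y" by simp
  have "y $ i = x $ i * hprod x y" for i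
  proof -
    have "y $ i = y $ i * hprod y y" using assms by (simp add: hprod_self)
    also have "\<dots> = (\<Sum>j\<in>UNIV. outer y $ i $ j * y $ j)"
      by (simp add: hprod_def outer_def sum_distrib_left mult.assoc)
    also have "\<dots> = x $ i * hprod x y"
      unfolding eq[symmetric] by (simp add: hprod_def outer_def sum_distrib_left mult.assoc)
    finally show ?thesis .
  qed
  then show ?thesis by (simp add: vec_eq_iff)
qed

lemma mem_proj_point_self: "x \<in> proj_point x"
  unfolding proj_point_def by (intro CollectI exI[of _ 1]) (simp add: vec_eq_iff)

lemma proj_point_eq:
  fixes x y :: "'k::conj_div_algebra ^ 'n"
  assumes "y \<in> proj_point x"
  shows "proj_point y = proj_point x"
proof -
  obtain e where e: "e \<noteq> 0" "y = (\<chi> i. x $ i * e)" using assms by (auto simp: proj_point_def)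
  have "\<exists>g. (\<chi> i. x $ i * e * f) = (\<chi> i. x $ i * g) \<and> g \<noteq> 0" if "f \<noteq> 0" for f
    using that e by (intro exI[of _ "e * f"]) (simp add: mult.assoc)
  moreover have "\<exists>g. (\<chi> i. x $ i * f) = (\<chi> i. x $ i * e * g) \<and> g \<noteq> 0" if "f \<noteq> 0" for f
    proof (intro exI conjI)
    have "e * (inverse e * f) = f" using e by (simp flip: mult.assoc)
    then show "(\<chi> i. x $ i * f) = (\<chi> i. x $ i * e * (inverse e * f))" by (simp add: mult.assoc)
  qed (use that e in simp)
  ultimately show ?thesis using e(2) by (auto simp: proj_point_def)
qed

lemma norm_scale_right: "norm (\<chi> i. x $ i * e) = norm (x::'k::conj_div_algebra ^ 'n) * norm e"
proof -
  have "(norm (\<chi> i. x $ i * e))\<^sup>2 = (norm x * norm e)\<^sup>2"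
    by (simp add: norm_vec_def L2_set_def sum_nonneg norm_mult power_mult_distrib sum_distrib_right)
  then show ?thesis by (rule power2_eq_imp_eq) simp_all
qed

lemma norm_hprod_proj_point:
  fixes x y z :: "'k::conj_div_algebra ^ 'n"
  assumes "y \<in> proj_point z" "norm z = 1" "norm y = 1"
  shows "norm (hprod x y) = norm (hprod x z)"
proof -
  obtain e where e: "y = (\<chi> i. z $ i * e)" using assms by (auto simp: proj_point_def)
  then have "norm e = 1" using assms by (simp add: norm_scale_right)
  moreover have "hprod x y = hprod x z * e"
    by (simp add: hprod_def e sum_distrib_right mult.assoc)
  ultimately show ?thesis by (simp add: norm_mult)
qed

lemma unit_proj_point_iff:
  fixes x y :: "'k::conj_div_algebra ^ 'n"
  assumes "norm x = 1" "norm y = 1"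
  shows "y \<in> proj_point x \<longleftrightarrow> norm (hprod x y) = 1"
proof
  assume "y \<in> proj_point x"
  then show "norm (hprod x y) = 1"
    using norm_hprod_proj_point[of y x x] assms by (simp add: hprod_self)
next
  assume "norm (hprod x y) = 1"
  then show "y \<in> proj_point x"
    using outer_eqD[OF assms] by (auto simp: proj_point_def intro!: exI[of _ "hprod x y"])
qed

section \<open>Isotropic measures\<close>

locale isotropic =
  fixes \<mu> :: "('k::conj_div_algebra ^ 'n) measure"
  assumes isotropic: "isotropic_measure \<mu>"

sublocale isotropic \<subseteq> prob_space \<mu>
  using isotropic by (simp add: isotropic_measure_def)

text \<open>The projection onto the line of \<open>x\<close> with its trace part removed. At 0 the
  first term is 0 by division by zero; in every integral below the factor
  \<open>norm x powr q\<close> vanishes there.\<close>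

definition traceless :: "'k::conj_div_algebra ^ 'n \<Rightarrow> 'k ^ 'n ^ 'n" where
  "traceless x = (1 / (norm x)\<^sup>2) *\<^sub>R outer x - (1 / real CARD('n)) *\<^sub>R mat 1"

lemma traceless_props:
  fixes x :: "'k::conj_div_algebra ^ 'n"
  assumes "x \<noteq> 0"
  shows "adjoint_mat (traceless x) = traceless x" "mat 1 \<bullet> traceless x = 0"
    "traceless x \<bullet> traceless x = 1 - 1 / real CARD('n)"
  using assms
  by (simp_all add: traceless_def adjoint_diff adjoint_scaleR adjoint_outer adjoint_one inner_simps
      inner_mat1_outer inner_mat1_mat1 inner_outer hprod_self inner_commute[of "outer x" "mat 1"] power2_eq_square diff_divide_distrib)

lemma inner_traceless:
  fixes x y :: "'k::conj_div_algebra ^ 'n"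
  assumes "x \<noteq> 0" "y \<noteq> 0"
  shows "traceless x \<bullet> traceless y = (norm (hprod x y) / (norm x * norm y))\<^sup>2 - 1 / real CARD('n)"
  using assms
  by (simp add: traceless_def inner_simps inner_mat1_outer inner_mat1_mat1 inner_outer
      inner_commute[of "outer x" "mat 1"] power_divide power_mult_distrib diff_divide_distrib)

lemma norm_traceless_le:
  "norm (traceless (x::'k::conj_div_algebra ^ 'n)) \<le> 1 + norm (mat 1 :: 'k ^ 'n ^ 'n)"
proof -
  have "norm (traceless x) \<le> norm ((1 / (norm x)\<^sup>2) *\<^sub>R outer x) + norm ((1 / real CARD('n)) *\<^sub>R (mat 1 :: 'k ^ 'n ^ 'n))"
    unfolding traceless_def by (rule norm_triangle_ineq4)
  also have "\<dots> \<le> 1 + 1 * norm (mat 1 :: 'k ^ 'n ^ 'n)"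
    unfolding norm_scaleR by (intro add_mono mult_right_mono) (auto simp: norm_outer Suc_le_eq)
  finally show ?thesis by simp
qed

lemma norm_hprod_powr:
  fixes x y :: "'k::conj_div_algebra ^ 'n"
  shows "norm (hprod x y) powr q
    = norm x powr q * norm y powr q * ((norm (hprod x y) / (norm x * norm y))\<^sup>2) powr (q / 2)"
proof (cases "x = 0 \<or> y = 0")
  case True
  then show ?thesis by (auto simp: hprod_def)
next
  case False
  have "(a\<^sup>2) powr (q / 2) = a powr q" if "0 \<le> a" for a :: real
    using that by (cases "a = 0") (auto simp: powr_powr simp flip: powr_numeral)
  then show ?thesis using False by (simp add: powr_divide powr_mult)
qed

lemma mult_le_weighted_squares:
  fixes a t d :: real
  assumes "0 < d"
  shows "a * t \<le> a\<^sup>2 / (2 * d) + d / 2 * t\<^sup>2"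
proof -
  have "0 \<le> (a - d * t)\<^sup>2 / (2 * d)" using assms by simp
  also have "\<dots> = a\<^sup>2 / (2 * d) + d / 2 * t\<^sup>2 - a * t"
    using assms by (simp add: power2_eq_square field_simps)
  finally show ?thesis by simp
qed

section \<open>Integrals determined by isotropy\<close>

context isotropic
begin

lemma sets_eq [measurable_cong, simp]: "sets \<mu> = sets borel"
  using isotropic by (simp add: isotropic_measure_def)

lemma space_eq [simp]: "space \<mu> = UNIV"
  using sets_eq_imp_space_eq[OF sets_eq] by simp

lemma prob_UNIV: "prob UNIV = 1"
  using prob_space by simp

lemma integrable_outer: "integrable \<mu> outer"
  and integral_outer: "integral\<^sup>L \<mu> outer = (1 / real CARD('n)) *\<^sub>R mat 1"
  using isotropic by (auto simp: isotropic_measure_def has_bochner_integral_iff)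

lemma measurable_outer [measurable]: "outer \<in> borel_measurable \<mu>"
  using integrable_outer by simp

lemma integrable_inner_outer: "integrable \<mu> (\<lambda>x. X \<bullet> outer x)"
  using integrable_outer by simp

lemma integral_inner_outer: "(\<integral>x. X \<bullet> outer x \<partial>\<mu>) = (X \<bullet> mat 1) / real CARD('n)"
  using integrable_outer by (simp add: integral_outer)

lemma integrable_norm_power2: "integrable \<mu> (\<lambda>x. (norm x)\<^sup>2)"
  using integrable_inner_outer[of "mat 1"] by (simp add: inner_mat1_outer)

lemma integral_norm_power2: "(\<integral>x. (norm x)\<^sup>2 \<partial>\<mu>) = 1"
  using integral_inner_outer[of "mat 1"] by (simp add: inner_mat1_outer inner_mat1_mat1)

lemma integrable_norm_powr:
  assumes "0 \<le> p" "p \<le> 2"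
  shows "integrable \<mu> (\<lambda>x. norm x powr p)"
proof (rule Bochner_Integration.integrable_bound)
  show "integrable \<mu> (\<lambda>x. 1 + (norm x)\<^sup>2)" using integrable_norm_power2 by simp
  show "AE x in \<mu>. norm (norm x powr p) \<le> norm (1 + (norm x)\<^sup>2)"
  proof (rule AE_I2)
    fix x :: "'k ^ 'n"
    have "norm x powr p = ((norm x)\<^sup>2) powr (p / 2)"
      by (cases "x = 0") (auto simp: powr_powr simp flip: powr_numeral)
    also have "\<dots> \<le> (p / 2) * (norm x)\<^sup>2 + (1 - p / 2)"
      using assms by (intro powr_le_affine) auto
    also have "\<dots> \<le> 1 * (norm x)\<^sup>2 + 1"
      using assms by (intro add_mono mult_right_mono) auto
    finally show "norm (norm x powr p) \<le> norm (1 + (norm x)\<^sup>2)" by simp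
  qed
qed measurable

lemma integral_norm_matrix_vector_mult:
  fixes X :: "'k ^ 'n ^ 'n"
  shows "integrable \<mu> (\<lambda>x. (norm (X *v x))\<^sup>2)"
    "(\<integral>x. (norm (X *v x))\<^sup>2 \<partial>\<mu>) = (norm X)\<^sup>2 / real CARD('n)"
  unfolding norm_matrix_vector_mult_power2
  by (rule integrable_inner_outer) (simp only: integral_inner_outer inner_mat1_adjoint_mult)

lemma measurable_traceless [measurable]: "traceless \<in> borel_measurable \<mu>"
  unfolding traceless_def by measurable

end

section \<open>The weight \<open>norm x powr q\<close>: its mass and its traceless mean\<close>

locale isotropic_moment = isotropic \<mu> for \<mu> :: "('k::conj_div_algebra ^ 'n) measure" +
  fixes q :: real
  assumes q: "1 \<le> q" "q \<le> 2"
begin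

definition mass :: real where "mass = (\<integral>x. norm x powr q \<partial>\<mu>)"

definition deviation :: "'k ^ 'n ^ 'n" where
  "deviation = (\<integral>x. norm x powr q *\<^sub>R traceless x \<partial>\<mu>)"

lemma integrable_weight: "integrable \<mu> (\<lambda>x. norm x powr q)"
  using q by (intro integrable_norm_powr) auto

lemma integrable_weight_bounded:
  fixes f :: "'k ^ 'n \<Rightarrow> 'b::{banach, second_countable_topology}"
  assumes [measurable]: "f \<in> borel_measurable \<mu>" and "\<And>x. norm (f x) \<le> C"
  shows "integrable \<mu> (\<lambda>x. norm x powr q *\<^sub>R f x)"
proof (rule Bochner_Integration.integrable_bound)
  show "integrable \<mu> (\<lambda>x. norm x powr q * C)" using integrable_weight by simp
  show "AE x in \<mu>. norm (norm x powr q *\<^sub>R f x) \<le> norm (norm x powr q * C)"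
  proof (rule AE_I2)
    fix x
    have "norm (norm x powr q *\<^sub>R f x) = norm x powr q * norm (f x)" by simp
    also have "\<dots> \<le> norm x powr q * C" using assms(2) by (intro mult_left_mono) auto
    finally show "norm (norm x powr q *\<^sub>R f x) \<le> norm (norm x powr q * C)" by simp
  qed
qed measurable

lemma integrable_weight_traceless: "integrable \<mu> (\<lambda>x. norm x powr q *\<^sub>R traceless x)"
  by (rule integrable_weight_bounded[OF measurable_traceless norm_traceless_le])

lemma mass_nonneg: "0 \<le> mass"
  unfolding mass_def by simp

lemma weight_le_affine: "norm x powr q \<le> q / 2 * (norm (x::'k ^ 'n))\<^sup>2 + (1 - q / 2)"
  and weight_less_affine: "q < 2 \<Longrightarrow> norm x \<noteq> 1 \<Longrightarrow> norm x powr q < q / 2 * (norm (x::'k ^ 'n))\<^sup>2 + (1 - q / 2)"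
proof -
  have *: "norm x powr q = ((norm x)\<^sup>2) powr (q / 2)"
    by (cases "x = 0") (auto simp: powr_powr simp flip: powr_numeral)
  show "norm x powr q \<le> q / 2 * (norm x)\<^sup>2 + (1 - q / 2)"
    unfolding * using q by (intro powr_le_affine) auto
  assume "q < 2" "norm x \<noteq> 1"
  then show "norm x powr q < q / 2 * (norm x)\<^sup>2 + (1 - q / 2)"
    unfolding * using q norm_ge_zero[of x]
    by (intro powr_less_affine) (auto simp: power2_eq_1_iff simp del: norm_ge_zero)
qed

lemma integral_affine:
  "integrable \<mu> (\<lambda>x. q / 2 * (norm x)\<^sup>2 + (1 - q / 2))"
  "(\<integral>x. q / 2 * (norm x)\<^sup>2 + (1 - q / 2) \<partial>\<mu>) = 1"
  using integrable_norm_power2 by (simp_all add: integral_norm_power2 prob_UNIV)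

lemma mass_le_1: "mass \<le> 1"
proof -
  have "mass \<le> (\<integral>x. q / 2 * (norm x)\<^sup>2 + (1 - q / 2) \<partial>\<mu>)"
    unfolding mass_def by (intro integral_mono integrable_weight integral_affine weight_le_affine)
  then show ?thesis by (simp only: integral_affine)
qed

text \<open>The affine bound strictly exceeds the weight off the unit sphere, yet both then have
  integral 1.\<close>

lemma mass_eq_1D:
  assumes "q < 2" "mass = 1"
  shows "AE x in \<mu>. norm x = 1"
proof -
  let ?g = "\<lambda>x. q / 2 * (norm x)\<^sup>2 + (1 - q / 2) - norm (x::'k ^ 'n) powr q"
  have g: "integrable \<mu> ?g" "(\<integral>x. ?g x \<partial>\<mu>) = 0"
    using integrable_weight integral_affine assms(2)
    by (simp_all only: Bochner_Integration.integrable_diff Bochner_Integration.integral_diff mass_def[symmetric])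
  have "AE x in \<mu>. ?g x = 0"
    using g weight_le_affine by (subst integral_nonneg_eq_0_iff_AE[symmetric]) auto
  then show ?thesis
    by eventually_elim (use weight_less_affine[OF assms(1)] in force)
qed

text \<open>The left side is the second moment of \<open>norm x powr (q - 2)\<close> under the
  density \<open>(norm x)\<^sup>2\<close>. AM-GM is applied to \<open>norm x powr q\<close> with
  exponent \<open>2 - 2 / q\<close>, which lies in the unit interval because
  \<open>1 \<le> q \<le> 2\<close>.\<close>

lemma integral_powr_le:
  "(\<integral>x. norm x powr (2 * q - 2) \<partial>\<mu>) \<le> (1 - (2 - q) / q) * mass + (2 - q) / q"
proof -
  have "norm x powr (2 * q - 2) \<le> (1 - (2 - q) / q) * norm x powr q + (2 - q) / q" for x :: "'k ^ 'n"
  proof -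
    have "norm x powr (2 * q - 2) = (norm x powr q) powr (1 - (2 - q) / q)"
    proof -
      have "q * ((2 - q) / q) = 2 - q" using q by simp
      then have "q * (1 - (2 - q) / q) = 2 * q - 2" unfolding right_diff_distrib by simp
      then show ?thesis by (simp only: powr_powr)
    qed
    also have "\<dots> \<le> (1 - (2 - q) / q) * norm x powr q + (1 - (1 - (2 - q) / q))"
      using q by (intro powr_le_affine) (auto simp: field_simps)
    finally show ?thesis by simp
  qed
  then have "(\<integral>x. norm x powr (2 * q - 2) \<partial>\<mu>) \<le> (\<integral>x. (1 - (2 - q) / q) * norm x powr q + (2 - q) / q \<partial>\<mu>)"
    using q integrable_weight by (intro integral_mono integrable_norm_powr) auto
  also have "\<dots> = (1 - (2 - q) / q) * mass + (2 - q) / q"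
    using integrable_weight by (simp add: mass_def prob_UNIV)
  finally show ?thesis .
qed

text \<open>By isotropy the removed multiple of \<open>mat 1\<close> has the same mean as
  \<open>mass * outer x\<close>. The scalar factor becomes \<open>norm x powr (q - 2)\<close> minus
  its own mean under the density \<open>(norm x)\<^sup>2\<close>, so its square integrates to a
  variance.\<close>

lemma deviation_eq:
  "integrable \<mu> (\<lambda>x. (norm x powr (q - 2) - mass) *\<^sub>R outer x)"
  "deviation = (\<integral>x. (norm x powr (q - 2) - mass) *\<^sub>R outer x \<partial>\<mu>)"
proof -
  have eq: "norm x powr q *\<^sub>R traceless x = norm x powr (q - 2) *\<^sub>R outer x - (norm x powr q / real CARD('n)) *\<^sub>R mat 1"
    for x :: "'k ^ 'n"
  proof -
    have "norm x powr q / (norm x)\<^sup>2 = norm x powr (q - 2)"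
      by (cases "x = 0") (auto simp: powr_diff)
    then show ?thesis by (simp add: traceless_def scaleR_diff_right)
  qed
  have i1: "integrable \<mu> (\<lambda>x. (norm x powr q / real CARD('n)) *\<^sub>R (mat 1 :: 'k ^ 'n ^ 'n))"
    using integrable_weight by simp
  have "integrable \<mu> (\<lambda>x. norm x powr q *\<^sub>R traceless x + (norm x powr q / real CARD('n)) *\<^sub>R (mat 1 :: 'k ^ 'n ^ 'n))"
    using integrable_weight_traceless i1 by (rule Bochner_Integration.integrable_add)
  then have i2: "integrable \<mu> (\<lambda>x. norm x powr (q - 2) *\<^sub>R outer x)" by (simp add: eq)
  have i3: "integrable \<mu> (\<lambda>x. mass *\<^sub>R outer x)" using integrable_outer by simp
  show "integrable \<mu> (\<lambda>x. (norm x powr (q - 2) - mass) *\<^sub>R outer x)"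
    unfolding scaleR_diff_left using i2 i3 by (rule Bochner_Integration.integrable_diff)
  have "deviation = (\<integral>x. norm x powr (q - 2) *\<^sub>R outer x \<partial>\<mu>) - (\<integral>x. (norm x powr q / real CARD('n)) *\<^sub>R mat 1 \<partial>\<mu>)"
    unfolding deviation_def eq using i2 i1 by (rule Bochner_Integration.integral_diff)
  also have "(\<integral>x. (norm x powr q / real CARD('n)) *\<^sub>R (mat 1 :: 'k ^ 'n ^ 'n) \<partial>\<mu>) = (mass / real CARD('n)) *\<^sub>R mat 1"
    using integrable_weight by (simp add: mass_def)
  also have "(mass / real CARD('n)) *\<^sub>R mat 1 = (\<integral>x. mass *\<^sub>R outer x \<partial>\<mu>)"
    using integrable_outer by (simp add: integral_outer)
  finally show "deviation = (\<integral>x. (norm x powr (q - 2) - mass) *\<^sub>R outer x \<partial>\<mu>)"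
    unfolding scaleR_diff_left using Bochner_Integration.integral_diff[OF i2 i3] by simp
qed

text \<open>Pairing the deviation with itself and applying AM-GM pointwise reproduces half of the
  left-hand side, because \<open>\<integral> |Hx|\<^sup>2 = |H|\<^sup>2 / d\<close>.\<close>

lemma norm_deviation_le:
  "(norm deviation)\<^sup>2 \<le> ((\<integral>x. norm x powr (2 * q - 2) \<partial>\<mu>) - mass\<^sup>2) / real CARD('n)"
proof -
  let ?d = "real CARD('n)" and ?P = deviation
  let ?f = "\<lambda>x. (norm x powr (q - 2) - mass) * (outer x \<bullet> ?P)"
  let ?g = "\<lambda>x. (norm x powr (2 * q - 2) - 2 * mass * norm x powr q + mass\<^sup>2 * (norm x)\<^sup>2) / (2 * ?d)
      + ?d / 2 * (norm (?P *v x))\<^sup>2"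
  have d: "0 < ?d" by simp
  have le: "?f x \<le> ?g x" for x
  proof -
    define a where "a = norm x powr (q - 2) - mass"
    have "\<bar>outer x \<bullet> ?P\<bar> \<le> norm x * norm (?P *v x)"
      unfolding inner_outer_matrix by (rule Cauchy_Schwarz_ineq2)
    then have "?f x \<le> \<bar>a\<bar> * (norm x * norm (?P *v x))"
      unfolding a_def[symmetric]
      by - (rule order_trans[OF abs_ge_self], simp add: abs_mult mult_left_mono)
    also have "\<dots> \<le> (a\<^sup>2 * (norm x)\<^sup>2) / (2 * ?d) + ?d / 2 * (norm (?P *v x))\<^sup>2"
      using mult_le_weighted_squares[OF d, of "\<bar>a\<bar> * norm x" "norm (?P *v x)"]
      by (simp add: power_mult_distrib mult.assoc)
    \<comment> \<open>At \<open>x = 0\<close> and \<open>q = 1\<close> this relies on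
      \<open>0 powr 0 = 0\<close>.\<close>
    also have "a\<^sup>2 * (norm x)\<^sup>2 = norm x powr (2 * q - 2) - 2 * mass * norm x powr q + mass\<^sup>2 * (norm x)\<^sup>2"
    proof (cases "x = 0")
      case False
      have "norm x powr q = norm x powr (q - 2) * (norm x)\<^sup>2"
        using False by (simp add: powr_diff)
      moreover have "norm x powr (2 * q - 2) = (norm x powr (q - 2))\<^sup>2 * (norm x)\<^sup>2"
      proof -
        have "(norm x powr (q - 2))\<^sup>2 * (norm x)\<^sup>2 = norm x powr ((q - 2) + (q - 2) + 2)"
          using False by (simp only: powr_add) (simp add: power2_eq_square)
        then show ?thesis by simp
      qed
      ultimately show ?thesis unfolding a_def by (simp add: power2_diff algebra_simps)
    qed simp
    finally show ?thesis .
  qed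
  have f: "integrable \<mu> ?f" "(\<integral>x. ?f x \<partial>\<mu>) = (norm ?P)\<^sup>2"
  proof -
    have "?f x = ((norm x powr (q - 2) - mass) *\<^sub>R outer x) \<bullet> ?P" for x by simp
    then show "integrable \<mu> ?f" "(\<integral>x. ?f x \<partial>\<mu>) = (norm ?P)\<^sup>2"
      using deviation_eq(1) by (simp_all only: integrable_inner_left integral_inner_left deviation_eq(2)[symmetric] power2_norm_eq_inner)
  qed
  have i1: "integrable \<mu> (\<lambda>x. norm x powr (2 * q - 2))" using q by (intro integrable_norm_powr) auto
  note ints = i1 integrable_weight integrable_norm_power2 integral_norm_matrix_vector_mult(1)[of ?P]
  have "(norm ?P)\<^sup>2 \<le> (\<integral>x. ?g x \<partial>\<mu>)"
    unfolding f(2)[symmetric] by (intro integral_mono f(1) le) (use ints in simp)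
  also have "\<dots> = ((\<integral>x. norm x powr (2 * q - 2) \<partial>\<mu>) - 2 * mass * mass + mass\<^sup>2) / (2 * ?d)
      + ?d / 2 * ((norm ?P)\<^sup>2 / ?d)"
    using ints by (simp add: integral_norm_matrix_vector_mult(2) integral_norm_power2 flip: mass_def)
  also have "\<dots> = ((\<integral>x. norm x powr (2 * q - 2) \<partial>\<mu>) - mass\<^sup>2) / (2 * ?d) + (norm ?P)\<^sup>2 / 2"
    by (simp add: power2_eq_square)
  finally have "(norm ?P)\<^sup>2 \<le> ((\<integral>x. norm x powr (2 * q - 2) \<partial>\<mu>) - mass\<^sup>2) / ?d / 2 + (norm ?P)\<^sup>2 / 2"
    by (simp add: mult.commute)
  moreover have "N \<le> T" if "N \<le> T / 2 + N / 2" for N T :: real using that by simp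
  ultimately show ?thesis by blast
qed

end

section \<open>Integrating the majorant\<close>

lemma integral_sum_sum:
  fixes h :: "'b \<Rightarrow> 'b \<Rightarrow> 'a \<Rightarrow> real"
  assumes "\<And>e f. e \<in> A \<Longrightarrow> f \<in> A \<Longrightarrow> integrable M (h e f)"
  shows "(\<integral>x. (\<Sum>e\<in>A. \<Sum>f\<in>A. a e f * h e f x) \<partial>M) = (\<Sum>e\<in>A. \<Sum>f\<in>A. a e f * (\<integral>x. h e f x \<partial>M))"
proof -
  have "integrable M (\<lambda>x. a e f * h e f x)" if "e \<in> A" "f \<in> A" for e f
    using assms[OF that] by simp
  then show ?thesis by (simp add: Bochner_Integration.integral_sum)
qed

text \<open>The constants are real parameters pinned by equations, so that later algebra sees only
  the relations between them; \<open>beta2\<close> is the square of \<beta>.\<close>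

locale isotropic_bound = isotropic_moment \<mu> q
  for \<mu> :: "('k::conj_div_algebra ^ 'n) measure" and q +
  fixes dm msize beta2 :: real
  assumes dm_eq: "dm = real CARD('n)"
    and msize_eq: "msize = real (max_simplex_size DIM('k) CARD('n))"
    and beta2_eq: "beta2 = 1 / (dm + 2 / real DIM('k))"
begin

text \<open>The derivative of \<open>s powr (q / 2)\<close> at \<open>s = beta2\<close>.\<close>

definition slope :: real where "slope = q / 2 * beta2 powr (q / 2 - 1)"

text \<open>Solved from the requirement that the quadratic take the value 1 at
  \<open>s = 1\<close>.\<close>

definition curv :: real where
  "curv = (beta2 powr (q / 2) + slope * (1 - beta2) - 1) / (1 - beta2)\<^sup>2"

definition target :: real where
  "target = beta2 powr (q / 2) + (1 - beta2 powr (q / 2)) / msize"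

text \<open>A coordinate of the tensor from \<open>traceless_kernel_eq_Gram\<close>, so products
  summed over \<open>e\<close> and \<open>f\<close> give the kernel.\<close>

definition gram :: "'k ^ 'n ^ 'n \<Rightarrow> 'k ^ 'n ^ 'n \<Rightarrow> 'k ^ 'n \<Rightarrow> real" where
  "gram e f x = (traceless x \<bullet> e) * (traceless x \<bullet> f) - (1 - 1 / dm) / (msize - 1) * (herm0 e \<bullet> f)"

text \<open>The weighted quadratic in its rearranged form: each term is an inner product of a
  function of \<open>x\<close> with the same function of \<open>y\<close>, so its double integral is
  a multiple of a squared norm.\<close>

definition majorant :: "'k ^ 'n \<Rightarrow> 'k ^ 'n \<Rightarrow> real" where
  "majorant x y = norm x powr q * norm y powr q *
    (target + (slope - 2 * curv * (1 / dm - beta2)) * (traceless x \<bullet> traceless y)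
      - curv * (\<Sum>e\<in>Basis. \<Sum>f\<in>Basis. gram e f x * gram e f y))"

lemma beta2_props:
  "(msize - 1) * (1 / dm - beta2) = 1 - 1 / dm" "1 \<le> msize" "0 < beta2" "beta2 < 1" "beta2 \<le> 1 / dm"
  unfolding beta2_eq dm_eq msize_eq by (intro simplex_size_identity; simp)+

lemma curv_eq: "beta2 powr (q / 2) + slope * (1 - beta2) - curv * (1 - beta2)\<^sup>2 = 1"
  using beta2_props by (simp add: curv_def)

lemma curv_nonneg: "0 \<le> curv"
  using quadratic_coeff_nonneg[of beta2 "q / 2" curv] beta2_props q curv_eq by (simp add: slope_def)

text \<open>The Gram identity and \<open>quadratic_average\<close>, read backwards, recover the
  tangent quadratic in \<open>s\<close>.\<close>

lemma majorant_nonzero: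
  fixes x y :: "'k ^ 'n"
  assumes "x \<noteq> 0" "y \<noteq> 0"
  defines "s \<equiv> (norm (hprod x y) / (norm x * norm y))\<^sup>2"
  shows "majorant x y = norm x powr q * norm y powr q *
    (beta2 powr (q / 2) + slope * (s - beta2) - curv * (s - beta2)\<^sup>2)"
proof -
  have tr: "traceless x \<bullet> traceless y = s - 1 / dm"
    using inner_traceless[OF assms(1,2)] by (simp add: s_def dm_eq)
  have gr: "(\<Sum>e\<in>Basis. \<Sum>f\<in>Basis. gram e f x * gram e f y) = (s - 1 / dm)\<^sup>2 - (1 - 1 / dm)\<^sup>2 / (msize - 1)"
    using traceless_kernel_eq_Gram[OF traceless_props[OF assms(1)] traceless_props[OF assms(2)]]
    unfolding gram_def unfolding tr[symmetric] unfolding dm_eq msize_eq .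
  have "0 < msize" using beta2_props(2) by simp
  then show ?thesis
    unfolding majorant_def tr gr target_def
    by (simp only: quadratic_average[OF beta2_props(4) _ beta2_props(1) curv_eq, of s])
qed

lemma majorant_ge: "norm (hprod x y) powr q \<le> majorant x (y :: 'k ^ 'n)"
proof (cases "x = 0 \<or> y = 0")
  case True
  then show ?thesis by (auto simp: majorant_def hprod_def)
next
  case False
  let ?s = "(norm (hprod x y) / (norm x * norm y))\<^sup>2"
  have "?s \<le> 1" using False norm_hprod_le[of x y] by (simp add: power_le_one)
  then have "?s powr (q / 2) \<le> beta2 powr (q / 2) + slope * (?s - beta2) - curv * (?s - beta2)\<^sup>2"
    unfolding slope_def using beta2_props q curv_eq[unfolded slope_def] by (intro powr_le_quadratic) auto
  then show ?thesis
    using False by (simp add: norm_hprod_powr[of x y] majorant_nonzero mult_left_mono)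
qed

lemma majorant_eqD:
  fixes x y :: "'k ^ 'n"
  assumes "q < 2" "norm x = 1" "norm y = 1" "majorant x y = norm (hprod x y) powr q"
  shows "(norm (hprod x y))\<^sup>2 = beta2 \<or> norm (hprod x y) = 1"
proof (rule ccontr)
  let ?s = "(norm (hprod x y))\<^sup>2"
  assume neg: "\<not> ?thesis"
  have le: "norm (hprod x y) \<le> 1" using norm_hprod_le[of x y] assms by simp
  then have "?s < 1" using neg by (simp add: power_less_one_iff abs_square_less_1)
  have "?s powr (q / 2) < beta2 powr (q / 2) + slope * (?s - beta2) - curv * (?s - beta2)\<^sup>2"
    unfolding slope_def using beta2_props q assms curv_eq[unfolded slope_def] neg \<open>?s < 1\<close>
    by (intro powr_less_quadratic) auto
  moreover have "x \<noteq> 0" "y \<noteq> 0" using assms by auto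
  ultimately show False
    using assms norm_hprod_powr[of x y q] majorant_nonzero[of x y] by simp
qed

definition gram_mean :: "'k ^ 'n ^ 'n \<Rightarrow> 'k ^ 'n ^ 'n \<Rightarrow> real" where
  "gram_mean e f = (\<integral>x. norm x powr q * gram e f x \<partial>\<mu>)"

lemma integrable_gram:
  assumes "e \<in> Basis" "f \<in> Basis"
  shows "integrable \<mu> (\<lambda>x. norm x powr q * gram e f x)"
proof -
  let ?T = "1 + norm (mat 1 :: 'k ^ 'n ^ 'n)"
  have "norm (gram e f x) \<le> ?T * ?T + norm ((1 - 1 / dm) / (msize - 1) * (herm0 e \<bullet> f))" for x
  proof -
    have t: "\<bar>traceless x \<bullet> u\<bar> \<le> ?T" if "u \<in> Basis" for u
      using Basis_le_norm[OF that, of "traceless x"] norm_traceless_le[of x] by simp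
    have "norm (gram e f x) \<le> norm ((traceless x \<bullet> e) * (traceless x \<bullet> f))
        + norm ((1 - 1 / dm) / (msize - 1) * (herm0 e \<bullet> f))"
      unfolding gram_def by (rule norm_triangle_ineq4)
    also have "norm ((traceless x \<bullet> e) * (traceless x \<bullet> f)) \<le> ?T * ?T"
      unfolding real_norm_def abs_mult using t assms by (intro mult_mono) auto
    finally show ?thesis by simp
  qed
  moreover have "gram e f \<in> borel_measurable \<mu>" unfolding gram_def by measurable
  ultimately show ?thesis
    using integrable_weight_bounded[of "gram e f"] unfolding real_scaleR_def by blast
qed

lemma majorant_expand:
  "majorant x y = target * (norm x powr q * norm y powr q)
    + (slope - 2 * curv * (1 / dm - beta2)) * ((norm x powr q *\<^sub>R traceless x) \<bullet> (norm y powr q *\<^sub>R traceless y))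
    - curv * (\<Sum>e\<in>Basis. \<Sum>f\<in>Basis. (norm x powr q * gram e f x) * (norm y powr q * gram e f y))"
  unfolding majorant_def
  by (simp add: algebra_simps sum_distrib_left)

lemma integral_majorant_inner:
  "integrable \<mu> (majorant x)"
  "(\<integral>y. majorant x y \<partial>\<mu>) = target * (norm x powr q * mass)
    + (slope - 2 * curv * (1 / dm - beta2)) * ((norm x powr q *\<^sub>R traceless x) \<bullet> deviation)
    - curv * (\<Sum>e\<in>Basis. \<Sum>f\<in>Basis. (norm x powr q * gram e f x) * gram_mean e f)"
proof -
  have i1: "integrable \<mu> (\<lambda>y. target * (norm x powr q * norm y powr q))"
    using integrable_weight by simp
  have i2: "integrable \<mu> (\<lambda>y. (slope - 2 * curv * (1 / dm - beta2)) *
      ((norm x powr q *\<^sub>R traceless x) \<bullet> (norm y powr q *\<^sub>R traceless y)))"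
    using integrable_weight_traceless by (intro integrable_mult_right integrable_inner_right)
  have i3: "integrable \<mu> (\<lambda>y. curv * (\<Sum>e\<in>Basis. \<Sum>f\<in>Basis. (norm x powr q * gram e f x) * (norm y powr q * gram e f y)))"
    using integrable_gram by (intro integrable_mult_right Bochner_Integration.integrable_sum)
  have e3: "(\<integral>y. curv * (\<Sum>e\<in>Basis. \<Sum>f\<in>Basis. (norm x powr q * gram e f x) * (norm y powr q * gram e f y)) \<partial>\<mu>)
      = curv * (\<Sum>e\<in>Basis. \<Sum>f\<in>Basis. (norm x powr q * gram e f x) * gram_mean e f)"
    unfolding gram_mean_def integral_mult_right_zero
    by (intro arg_cong2[where f = "(*)"] refl integral_sum_sum integrable_gram)
  have e2: "(\<integral>y. (slope - 2 * curv * (1 / dm - beta2)) *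
      ((norm x powr q *\<^sub>R traceless x) \<bullet> (norm y powr q *\<^sub>R traceless y)) \<partial>\<mu>)
    = (slope - 2 * curv * (1 / dm - beta2)) * ((norm x powr q *\<^sub>R traceless x) \<bullet> deviation)"
    using integrable_weight_traceless unfolding deviation_def
    by (simp only: integral_mult_right_zero integral_inner_right)
  have e1: "(\<integral>y. target * (norm x powr q * norm y powr q) \<partial>\<mu>) = target * (norm x powr q * mass)"
    unfolding mass_def by (simp only: integral_mult_right_zero)
  note i12 = Bochner_Integration.integrable_add[OF i1 i2]
  show "integrable \<mu> (majorant x)"
    using Bochner_Integration.integrable_diff[OF i12 i3] by (simp only: majorant_expand[abs_def])
  show "(\<integral>y. majorant x y \<partial>\<mu>) = target * (norm x powr q * mass)
    + (slope - 2 * curv * (1 / dm - beta2)) * ((norm x powr q *\<^sub>R traceless x) \<bullet> deviation)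
    - curv * (\<Sum>e\<in>Basis. \<Sum>f\<in>Basis. (norm x powr q * gram e f x) * gram_mean e f)"
    unfolding majorant_expand Bochner_Integration.integral_diff[OF i12 i3]
      Bochner_Integration.integral_add[OF i1 i2] e1 e2 e3 ..
qed

lemma integral_majorant:
  "integrable \<mu> (\<lambda>x. \<integral>y. majorant x y \<partial>\<mu>)"
  "(\<integral>x. (\<integral>y. majorant x y \<partial>\<mu>) \<partial>\<mu>) = target * mass\<^sup>2
    + (slope - 2 * curv * (1 / dm - beta2)) * (norm deviation)\<^sup>2
    - curv * (\<Sum>e\<in>Basis. \<Sum>f\<in>Basis. (gram_mean e f)\<^sup>2)"
proof -
  have i1: "integrable \<mu> (\<lambda>x. target * (norm x powr q * mass))"
    using integrable_weight by simp
  have i2: "integrable \<mu> (\<lambda>x. (slope - 2 * curv * (1 / dm - beta2)) *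
      ((norm x powr q *\<^sub>R traceless x) \<bullet> deviation))"
    using integrable_weight_traceless by (intro integrable_mult_right integrable_inner_left)
  have i3: "integrable \<mu> (\<lambda>x. curv * (\<Sum>e\<in>Basis. \<Sum>f\<in>Basis. (norm x powr q * gram e f x) * gram_mean e f))"
    using integrable_gram by (intro integrable_mult_right integrable_mult_left Bochner_Integration.integrable_sum)
  have e3: "(\<integral>x. curv * (\<Sum>e\<in>Basis. \<Sum>f\<in>Basis. (norm x powr q * gram e f x) * gram_mean e f) \<partial>\<mu>)
      = curv * (\<Sum>e\<in>Basis. \<Sum>f\<in>Basis. (gram_mean e f)\<^sup>2)"
  proof -
    have "(\<integral>x. (\<Sum>e\<in>Basis. \<Sum>f\<in>Basis. (norm x powr q * gram e f x) * gram_mean e f) \<partial>\<mu>)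
        = (\<integral>x. (\<Sum>e\<in>Basis. \<Sum>f\<in>Basis. gram_mean e f * (norm x powr q * gram e f x)) \<partial>\<mu>)"
      by (simp only: mult.commute[of _ "gram_mean _ _"])
    also have "\<dots> = (\<Sum>e\<in>Basis. \<Sum>f\<in>Basis. gram_mean e f * (\<integral>x. norm x powr q * gram e f x \<partial>\<mu>))"
      by (intro integral_sum_sum integrable_gram)
    finally show ?thesis
      by (simp only: integral_mult_right_zero gram_mean_def[symmetric] power2_eq_square)
  qed
  have e2: "(\<integral>x. (slope - 2 * curv * (1 / dm - beta2)) *
      ((norm x powr q *\<^sub>R traceless x) \<bullet> deviation) \<partial>\<mu>)
    = (slope - 2 * curv * (1 / dm - beta2)) * (norm deviation)\<^sup>2"
    using integrable_weight_traceless
    by (simp only: integral_mult_right_zero integral_inner_left deviation_def[symmetric] power2_norm_eq_inner)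
  have e1: "(\<integral>x. target * (norm x powr q * mass) \<partial>\<mu>) = target * mass\<^sup>2"
    unfolding mass_def power2_eq_square by (simp only: integral_mult_right_zero integral_mult_left_zero)
  note i12 = Bochner_Integration.integrable_add[OF i1 i2]
  show "integrable \<mu> (\<lambda>x. \<integral>y. majorant x y \<partial>\<mu>)"
    unfolding integral_majorant_inner using Bochner_Integration.integrable_diff[OF i12 i3] .
  show "(\<integral>x. (\<integral>y. majorant x y \<partial>\<mu>) \<partial>\<mu>) = target * mass\<^sup>2
    + (slope - 2 * curv * (1 / dm - beta2)) * (norm deviation)\<^sup>2
    - curv * (\<Sum>e\<in>Basis. \<Sum>f\<in>Basis. (gram_mean e f)\<^sup>2)"
    unfolding integral_majorant_inner Bochner_Integration.integral_diff[OF i12 i3]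
      Bochner_Integration.integral_add[OF i1 i2] e1 e2 e3 ..
qed

text \<open>The Gram term is a nonnegative multiple of a sum of squares, and
  \<open>beta2 \<le> 1 / dm\<close> means that the correction to \<open>slope\<close> only lowers
  the coefficient.\<close>

lemma integral_majorant_le:
  "(\<integral>x. (\<integral>y. majorant x y \<partial>\<mu>) \<partial>\<mu>) \<le> target * mass\<^sup>2 + slope * (norm deviation)\<^sup>2"
proof -
  have "0 \<le> curv * (\<Sum>e\<in>(Basis :: ('k ^ 'n ^ 'n) set). \<Sum>f\<in>Basis. (gram_mean e f)\<^sup>2)"
    using curv_nonneg by (intro mult_nonneg_nonneg sum_nonneg) auto
  moreover have "0 \<le> 2 * curv * (1 / dm - beta2) * (norm deviation)\<^sup>2"
    using curv_nonneg beta2_props by (intro mult_nonneg_nonneg) auto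
  ultimately show ?thesis unfolding integral_majorant left_diff_distrib[of slope] by linarith
qed

section \<open>Integrability of the moment and comparison with the majorant\<close>

lemma measurable_hprod [measurable]:
  "(\<lambda>(x, y). norm (hprod x y) powr q) \<in> borel_measurable (\<mu> \<Otimes>\<^sub>M \<mu>)"
proof -
  have "norm (hprod x y) = sqrt (outer x \<bullet> outer y)" for x y :: "'k ^ 'n"
    by (simp add: inner_outer)
  then show ?thesis by simp
qed

lemma integrable_hprod:
  "integrable \<mu> (\<lambda>y. norm (hprod x y) powr q)"
proof (rule Bochner_Integration.integrable_bound[OF integral_majorant_inner(1)])
  show "(\<lambda>y. norm (hprod x y) powr q) \<in> borel_measurable \<mu>"
    using measurable_Pair2[OF measurable_hprod, of x] by simp
  show "AE y in \<mu>. norm (norm (hprod x y) powr q) \<le> norm (majorant x y)"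
    using majorant_ge by (intro AE_I2) (smt (verit) powr_ge_zero real_norm_def)
qed

lemma integral_hprod_le: "(\<integral>y. norm (hprod x y) powr q \<partial>\<mu>) \<le> (\<integral>y. majorant x y \<partial>\<mu>)"
  by (intro integral_mono integrable_hprod integral_majorant_inner majorant_ge)

lemma integrable_hprod_outer:
  "integrable \<mu> (\<lambda>x. \<integral>y. norm (hprod x y) powr q \<partial>\<mu>)"
proof (rule Bochner_Integration.integrable_bound[OF integral_majorant(1)])
  show "(\<lambda>x. \<integral>y. norm (hprod x y) powr q \<partial>\<mu>) \<in> borel_measurable \<mu>"
    using measurable_hprod by (intro borel_measurable_lebesgue_integral)
  have "0 \<le> (\<integral>y. norm (hprod x y) powr q \<partial>\<mu>)" for x by simp
  then show "AE x in \<mu>. norm (\<integral>y. norm (hprod x y) powr q \<partial>\<mu>) \<le> norm (\<integral>y. majorant x y \<partial>\<mu>)"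
    using integral_hprod_le by (intro AE_I2) (smt (verit) real_norm_def)
qed

lemma moment_le_majorant: "moment q \<mu> \<le> (\<integral>x. (\<integral>y. majorant x y \<partial>\<mu>) \<partial>\<mu>)"
  unfolding moment_def
  by (intro integral_mono integrable_hprod_outer integral_majorant(1) integral_hprod_le)

lemma moment_eq_majorantD:
  assumes "moment q \<mu> = (\<integral>x. (\<integral>y. majorant x y \<partial>\<mu>) \<partial>\<mu>)"
  shows "AE x in \<mu>. AE y in \<mu>. majorant x y = norm (hprod x y) powr q"
proof -
  have "(\<integral>x. (\<integral>y. majorant x y \<partial>\<mu>) - (\<integral>y. norm (hprod x y) powr q \<partial>\<mu>) \<partial>\<mu>) = 0"
    using assms integral_majorant(1) integrable_hprod_outer by (simp add: moment_def)
  then have "AE x in \<mu>. (\<integral>y. majorant x y \<partial>\<mu>) - (\<integral>y. norm (hprod x y) powr q \<partial>\<mu>) = 0"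
    using integral_majorant(1) integrable_hprod_outer integral_hprod_le
    by (subst (asm) integral_nonneg_eq_0_iff_AE) auto
  then show ?thesis
  proof eventually_elim
    case (elim x)
    then have "(\<integral>y. majorant x y - norm (hprod x y) powr q \<partial>\<mu>) = 0"
      using integral_majorant_inner(1) integrable_hprod by simp
    then have "AE y in \<mu>. majorant x y - norm (hprod x y) powr q = 0"
      using integral_majorant_inner(1) integrable_hprod majorant_ge
      by (subst (asm) integral_nonneg_eq_0_iff_AE) auto
    then show ?case by eventually_elim simp
  qed
qed

end

section \<open>The bound and the case of equality\<close>

context isotropic_bound
begin

text \<open>The rate at which the deviation term can offset the loss in mass. In dimension one the
  traceless matrices vanish, so 0 suffices; the estimate of \<open>slope / dm\<close> below is made
  for \<open>dm \<ge> 2\<close>.\<close>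

definition gain :: real where "gain = (if dm = 1 then 0 else slope / dm)"

lemma slope_nonneg: "0 \<le> slope"
  using q by (simp add: slope_def)

lemma target_gt: "beta2 powr (q / 2) < target"
proof -
  have "beta2 powr (q / 2) < 1 powr (q / 2)"
    using beta2_props q by (intro powr_less_mono2) auto
  then show ?thesis using beta2_props(2) by (simp add: target_def)
qed

lemma target_pos: "0 < target"
  using target_gt by (rule le_less_trans[rotated]) simp

text \<open>For \<open>dm \<ge> 2\<close> the quotient \<open>1 / (dm * beta2)\<close> is at most 2,
  so \<open>slope / dm\<close> is at most \<open>q * beta2 powr (q / 2)\<close>, which is below
  \<open>q * target\<close>.\<close>

lemma gain_less: "gain < q * target"
proof (cases "dm = 1")
  case True
  then show ?thesis unfolding gain_def using q target_pos by simp
next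
  case False
  from False have "CARD('n) \<noteq> 1" by (auto simp: dm_eq)
  moreover have "0 < CARD('n)" by simp
  ultimately have "2 \<le> CARD('n)" by linarith
  then have dm: "2 \<le> dm" by (simp add: dm_eq)
  have k: "1 \<le> real DIM('k)" by (simp add: Suc_le_eq)
  have "2 / real DIM('k) \<le> 2 / 1" using k by (intro divide_left_mono) auto
  then have "2 / real DIM('k) \<le> dm" using dm by simp
  then have "1 / beta2 \<le> 2 * dm" unfolding beta2_eq by simp
  then have b: "1 / (dm * beta2) \<le> 2" using dm beta2_props by (simp add: field_simps)
  have "slope / dm = q / 2 * beta2 powr (q / 2) * (1 / (dm * beta2))"
    using beta2_props dm by (simp add: slope_def powr_diff)
  also have "\<dots> \<le> q / 2 * beta2 powr (q / 2) * 2"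
    using b q by (intro mult_left_mono) auto
  also have "\<dots> < q * target" using target_gt q by simp
  finally show ?thesis using False by (simp add: gain_def)
qed

text \<open>With \<open>t = (2 - q) / q\<close>, the variance bound
  \<open>(1 - t) * mass + t - mass\<^sup>2\<close> has the factor \<open>1 - mass\<close>, so the
  deviation is charged to the loss in mass.\<close>

lemma slope_deviation_le:
  "slope * (norm deviation)\<^sup>2 \<le> gain * ((1 - mass) * (mass + (2 - q) / q))"
proof (cases "dm = 1")
  case True
  have "norm x powr q *\<^sub>R traceless x = 0" for x :: "'k ^ 'n"
    using traceless_props(3)[of x] True by (cases "x = 0") (auto simp: dm_eq)
  then have "deviation = 0" unfolding deviation_def by (simp only: integral_zero)
  then show ?thesis unfolding gain_def using True by simp
next
  case False
  have "(norm deviation)\<^sup>2 \<le> ((1 - mass) * (mass + (2 - q) / q)) / dm"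
    unfolding dm_eq
  proof (rule order_trans[OF norm_deviation_le], rule divide_right_mono)
    have "(1 - mass) * (mass + t) = (1 - t) * mass + t - mass\<^sup>2" for t
      by (simp add: algebra_simps power2_eq_square)
    then show "(\<integral>x. norm x powr (2 * q - 2) \<partial>\<mu>) - mass\<^sup>2 \<le> (1 - mass) * (mass + (2 - q) / q)"
      using integral_powr_le by simp
  qed simp
  then have "slope * (norm deviation)\<^sup>2 \<le> slope * (((1 - mass) * (mass + (2 - q) / q)) / dm)"
    using slope_nonneg by (rule mult_left_mono)
  then show ?thesis using False by (simp add: gain_def)
qed

text \<open>After \<open>gain_less\<close> it remains to see
  \<open>q * mass + 2 - q \<le> 1 + mass\<close>, that is
  \<open>(q - 1) * (mass - 1) \<le> 0\<close>; here \<open>1 \<le> q\<close> enters. For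
  \<open>q < 2\<close> the factor \<open>mass + (2 - q) / q\<close> is positive and strictness
  survives.\<close>

lemma gain_mass_le: "gain * (mass + (2 - q) / q) \<le> target * (1 + mass)"
  and gain_mass_less: "q < 2 \<Longrightarrow> gain * (mass + (2 - q) / q) < target * (1 + mass)"
proof -
  have "(q - 1) * (mass - 1) \<le> 0" using q mass_le_1 by (intro mult_nonneg_nonpos) auto
  moreover have "q * (mass + (2 - q) / q) = q * mass + 2 - q"
    using q by (simp add: distrib_left)
  ultimately have "q * (mass + (2 - q) / q) \<le> 1 + mass"
    by (simp add: algebra_simps)
  then have 1: "target * (q * (mass + (2 - q) / q)) \<le> target * (1 + mass)"
    using target_pos by (intro mult_left_mono) auto
  have pos: "0 \<le> mass + (2 - q) / q" using q mass_nonneg by simp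
  have "gain * (mass + (2 - q) / q) \<le> q * target * (mass + (2 - q) / q)"
    using gain_less pos by (intro mult_right_mono) auto
  with 1 show "gain * (mass + (2 - q) / q) \<le> target * (1 + mass)" by (simp add: mult_ac)
  assume "q < 2"
  then have "0 < mass + (2 - q) / q" using q mass_nonneg by (simp add: add_nonneg_pos)
  then have "gain * (mass + (2 - q) / q) < q * target * (mass + (2 - q) / q)"
    using gain_less by (intro mult_strict_right_mono) auto
  with 1 show "gain * (mass + (2 - q) / q) < target * (1 + mass)" by (simp add: mult_ac)
qed

lemma integral_majorant_le_target:
  "(\<integral>x. (\<integral>y. majorant x y \<partial>\<mu>) \<partial>\<mu>)
    \<le> target - (1 - mass) * (target * (1 + mass) - gain * (mass + (2 - q) / q))"
proof -
  have "(1 - mass) * (target * (1 + mass) - gain * (mass + (2 - q) / q))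
    = target - target * mass\<^sup>2 - gain * ((1 - mass) * (mass + (2 - q) / q))"
    by (simp add: power2_eq_square algebra_simps)
  then show ?thesis using integral_majorant_le slope_deviation_le by linarith
qed

lemma moment_le_target: "moment q \<mu> \<le> target"
proof -
  have "0 \<le> (1 - mass) * (target * (1 + mass) - gain * (mass + (2 - q) / q))"
    using gain_mass_le mass_le_1 by (intro mult_nonneg_nonneg) auto
  then show ?thesis using moment_le_majorant integral_majorant_le_target by linarith
qed

text \<open>Equality makes the loss term \<open>?r\<close> vanish; its second factor is positive for
  \<open>q < 2\<close>, so \<open>mass = 1\<close>. The majorant is then attained almost surely,
  which leaves only its contact points.\<close>

lemma moment_eq_targetD:
  assumes "q < 2" "moment q \<mu> = target"
  shows "AE x in \<mu>. norm x = 1"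
    "AE x in \<mu>. AE y in \<mu>. norm y = 1 \<and> ((norm (hprod x y))\<^sup>2 = beta2 \<or> norm (hprod x y) = 1)"
proof -
  let ?r = "(1 - mass) * (target * (1 + mass) - gain * (mass + (2 - q) / q))"
  have g: "0 < target * (1 + mass) - gain * (mass + (2 - q) / q)"
    using gain_mass_less[OF assms(1)] by simp
  then have "0 \<le> ?r" using mass_le_1 by (intro mult_nonneg_nonneg) auto
  then have "?r = 0" and eq: "moment q \<mu> = (\<integral>x. (\<integral>y. majorant x y \<partial>\<mu>) \<partial>\<mu>)"
    using moment_le_majorant integral_majorant_le_target assms(2) by linarith+
  then have "mass = 1" using g by simp
  then show unit: "AE x in \<mu>. norm x = 1" by (rule mass_eq_1D[OF assms(1)])
  show "AE x in \<mu>. AE y in \<mu>. norm y = 1 \<and> ((norm (hprod x y))\<^sup>2 = beta2 \<or> norm (hprod x y) = 1)"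
    using moment_eq_majorantD[OF eq] unit
  proof eventually_elim
    case (elim x)
    from elim(1) unit show ?case
      by eventually_elim (use majorant_eqD[OF assms(1) elim(2)] in auto)
  qed
qed

text \<open>The squared modulus is 1 on the class of \<open>x\<close> and \<open>beta2\<close>
  elsewhere, while isotropy fixes its mean at \<open>1 / dm\<close>. Solving for the mass of the
  class gives the value.\<close>

lemma measure_unit_proj_point:
  assumes x: "norm x = 1"
    and ae: "AE y in \<mu>. norm y = 1 \<and> ((norm (hprod x y))\<^sup>2 = beta2 \<or> norm (hprod x y) = 1)"
  shows "{y \<in> proj_point x. norm y = 1} \<in> sets \<mu>"
    "measure \<mu> {y \<in> proj_point x. norm y = 1} = 1 / msize"
proof -
  let ?C = "{y \<in> proj_point x. norm y = 1}"
  \<comment> \<open>On unit vectors the class is a level set of a function of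
    \<open>outer y\<close>, hence measurable.\<close>
  have C: "?C = {y \<in> space \<mu>. norm y = 1 \<and> outer x \<bullet> outer y = 1}"
    using unit_proj_point_iff[OF x] by (auto simp: inner_outer power2_eq_1_iff) (smt (verit) norm_ge_zero)+
  show meas: "?C \<in> sets \<mu>" unfolding C by measurable
  have "(\<integral>y. outer x \<bullet> outer y \<partial>\<mu>) = 1 / dm"
    using x inner_mat1_outer[of x]
    by (simp add: integral_inner_outer inner_commute[of "outer x" "mat 1"] dm_eq)
  moreover have "(\<integral>y. outer x \<bullet> outer y \<partial>\<mu>) = (\<integral>y. beta2 + (1 - beta2) * indicator ?C y \<partial>\<mu>)"
  proof (rule integral_cong_AE)
    show "AE y in \<mu>. outer x \<bullet> outer y = beta2 + (1 - beta2) * indicator ?C y"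
      using ae
    proof eventually_elim
      case (elim y)
      then show ?case
        using unit_proj_point_iff[OF x, of y] beta2_props by (auto simp: inner_outer indicator_def)
    qed
  qed (use meas in measurable)
  moreover have "(\<integral>y. beta2 + (1 - beta2) * indicator ?C y \<partial>\<mu>) = beta2 + (1 - beta2) * measure \<mu> ?C"
  proof -
    have "integrable \<mu> (indicator ?C :: _ \<Rightarrow> real)"
      using meas by (intro integrable_real_indicator) (simp_all add: emeasure_eq_measure)
    then show ?thesis using meas by (simp add: prob_UNIV)
  qed
  ultimately have "(1 - beta2) * measure \<mu> ?C = 1 / dm - beta2" by simp
  moreover have "msize * (1 / dm - beta2) = 1 - beta2"
    using beta2_props(1) by (simp add: left_diff_distrib)
  moreover have "(1 - beta2) * (msize * measure \<mu> ?C) = msize * ((1 - beta2) * measure \<mu> ?C)"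
    by (rule mult.left_commute)
  ultimately have "(1 - beta2) * (msize * measure \<mu> ?C) = (1 - beta2) * 1" by simp
  then have "msize * measure \<mu> ?C = 1" using beta2_props by (simp only: mult_cancel_left) simp
  then show "measure \<mu> ?C = 1 / msize" using beta2_props(2) by (simp add: field_simps)
qed

end

section \<open>Pushing measures forward to projective space\<close>

lemma space_projective_borel: "space (projective_borel :: ('k::conj_div_algebra ^ 'n) set measure) = projective_space"
  unfolding projective_borel_def by (intro space_measure_of) auto

lemma proj_point_of_mem:
  assumes "p \<in> projective_space" "x \<in> p"
  shows "proj_point x = p" "x \<noteq> 0"
proof -
  obtain z where z: "z \<noteq> 0" "p = proj_point z" using assms(1) by (auto simp: projective_space_def)
  show "proj_point x = p" using assms z proj_point_eq by blast
  obtain e where e: "e \<noteq> 0" "x = (\<chi> i. z $ i * e)" using assms z by (auto simp: proj_point_def)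
  then have "norm x = norm z * norm e" by (simp only: norm_scale_right)
  then show "x \<noteq> 0" using e z by auto
qed

text \<open>The preimage of a generator \<open>U\<close> is \<open>\<Union> U\<close>, which is open
  by the choice of generators and avoids 0.\<close>

lemma (in isotropic) measurable_proj_point:
  "proj_point \<in> measurable (restrict_space \<mu> (- {0})) projective_borel"
  unfolding projective_borel_def
proof (rule measurable_measure_of)
  show "{U. U \<subseteq> projective_space \<and> open (\<Union> U)} \<subseteq> Pow (projective_space :: ('k ^ 'n) set set)" by auto
  show "proj_point \<in> space (restrict_space \<mu> (- {0})) \<rightarrow> projective_space"
    by (auto simp: space_restrict_space projective_space_def)
  fix U :: "('k ^ 'n) set set"
  assume "U \<in> {U. U \<subseteq> projective_space \<and> open (\<Union> U)}"
  then have U: "U \<subseteq> projective_space" "open (\<Union> U)" by auto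
  have "proj_point -` U \<inter> space (restrict_space \<mu> (- {0})) = \<Union> U"
  proof (intro equalityI subsetI)
    fix x assume "x \<in> proj_point -` U \<inter> space (restrict_space \<mu> (- {0}))"
    then show "x \<in> \<Union> U" using mem_proj_point_self[of x] by auto
  next
    fix x assume "x \<in> \<Union> U"
    then obtain p where "p \<in> U" "x \<in> p" by auto
    then show "x \<in> proj_point -` U \<inter> space (restrict_space \<mu> (- {0}))"
      using proj_point_of_mem[of p x] U by (auto simp: space_restrict_space)
  qed
  then show "proj_point -` U \<inter> space (restrict_space \<mu> (- {0})) \<in> sets (restrict_space \<mu> (- {0}))"
    using U proj_point_of_mem(2) by (subst sets_restrict_space_iff) auto
qed

text \<open>Up to a null set, the preimage of \<open>A\<close> is the disjoint union of the unit
  vectors in the points of \<open>S \<inter> A\<close>, each contributing the same mass.\<close>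

lemma (in isotropic) uniform_overI:
  fixes S :: "('k ^ 'n) set set"
  assumes S: "finite S" "S \<noteq> {}" "S \<subseteq> projective_space"
    and unit: "AE x in \<mu>. norm x = 1" and ae: "AE x in \<mu>. proj_point x \<in> S"
    and meas: "\<And>p. p \<in> S \<Longrightarrow> {y \<in> p. norm y = 1} \<in> sets \<mu>"
    and eq: "\<And>p. p \<in> S \<Longrightarrow> measure \<mu> {y \<in> p. norm y = 1} = 1 / card S"
  shows "uniform_over \<mu> S"
  unfolding uniform_over_def
proof (intro conjI unit measure_eqI)
  let ?R = "restrict_space \<mu> (- {0})"
  fix A assume "A \<in> sets (distr ?R projective_borel proj_point)"
  then have A: "A \<in> sets projective_borel" by simp
  then have "A \<subseteq> projective_space" using sets.sets_into_space space_projective_borel by blast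
  have m0: "- {0} \<inter> space \<mu> \<in> sets \<mu>" by auto
  let ?P = "proj_point -` A \<inter> space ?R"
  have P: "?P \<in> sets ?R" by (rule measurable_sets[OF measurable_proj_point A])
  then have P': "?P \<in> sets \<mu>" using m0 by (simp add: sets_restrict_space_iff)
  have "emeasure (distr ?R projective_borel proj_point) A = emeasure ?R ?P"
    by (rule emeasure_distr[OF measurable_proj_point A])
  also have "\<dots> = emeasure \<mu> ?P"
    using m0 by (intro emeasure_restrict_space) (auto simp: space_restrict_space)
  also have "\<dots> = emeasure \<mu> (\<Union>p\<in>S \<inter> A. {y \<in> p. norm y = 1})"
  proof (rule emeasure_eq_AE)
    show "AE x in \<mu>. x \<in> ?P \<longleftrightarrow> x \<in> (\<Union>p\<in>S \<inter> A. {y \<in> p. norm y = 1})"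
      using unit ae
    proof eventually_elim
      case (elim x)
      then have "x \<noteq> 0" by auto
      then show ?case
        using elim mem_proj_point_self[of x] proj_point_of_mem(1)[of _ x] S(3)
        by (auto simp: space_restrict_space)
    qed
  qed (use P' meas S in auto)
  also have "\<dots> = ennreal (measure \<mu> (\<Union>p\<in>S \<inter> A. {y \<in> p. norm y = 1}))"
    by (rule emeasure_eq_measure)
  also have "measure \<mu> (\<Union>p\<in>S \<inter> A. {y \<in> p. norm y = 1}) = (\<Sum>p\<in>S \<inter> A. measure \<mu> {y \<in> p. norm y = 1})"
  proof (rule finite_measure_finite_Union)
    show "disjoint_family_on (\<lambda>p. {y \<in> p. norm y = 1}) (S \<inter> A)"
      unfolding disjoint_family_on_def using proj_point_of_mem(1) S(3) by blast
  qed (use S meas in auto)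
  also have "\<dots> = card (S \<inter> A) / card S" by (simp add: eq)
  also have "ennreal \<dots> = emeasure (uniform_count_measure S) (S \<inter> A)"
    using S by (subst emeasure_uniform_count_measure) auto
  also have "\<dots> = emeasure (distr (uniform_count_measure S) projective_borel (\<lambda>p. p)) A"
  proof (subst emeasure_distr)
    show "(\<lambda>p. p) \<in> measurable (uniform_count_measure S) projective_borel"
      using S(3) by (auto simp: measurable_def space_uniform_count_measure space_projective_borel sets_uniform_count_measure)
    show "emeasure (uniform_count_measure S) (S \<inter> A)
      = emeasure (uniform_count_measure S) ((\<lambda>p. p) -` A \<inter> space (uniform_count_measure S))"
      by (simp add: space_uniform_count_measure Int_commute)
  qed (rule A)
  finally show "emeasure (distr ?R projective_borel proj_point) A
    = emeasure (distr (uniform_count_measure S) projective_borel (\<lambda>p. p)) A" .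
qed simp

section \<open>Extracting the maximal simplex from equality\<close>

context isotropic_bound
begin

lemma moment_eq_target_simplex:
  assumes "q < 2" "moment q \<mu> = target"
  obtains S where "maximal_simplex S" "uniform_over \<mu> S"
proof -
  \<comment> \<open>The simplex is built from those \<open>x\<close> for which the dichotomy holds
    for almost every \<open>y\<close>; almost every \<open>x\<close> qualifies.\<close>
  define good where "good x \<longleftrightarrow> norm x = 1 \<and>
    (AE y in \<mu>. norm y = 1 \<and> ((norm (hprod x y))\<^sup>2 = beta2 \<or> norm (hprod x y) = 1))" for x :: "'k ^ 'n"
  note unit = moment_eq_targetD(1)[OF assms]
  have good: "AE x in \<mu>. good x"
    unfolding good_def using moment_eq_targetD[OF assms] by eventually_elim simp
  define S where "S = proj_point ` Collect good"
  define cls where "cls p = {y \<in> p. norm y = 1}" for p :: "('k ^ 'n) set"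
  have cls: "cls p \<in> sets \<mu>" "measure \<mu> (cls p) = 1 / msize" if "p \<in> S" for p
    using that measure_unit_proj_point by (auto simp: S_def good_def cls_def)
  have S_sub: "S \<subseteq> projective_space"
    by (auto simp: S_def projective_space_def good_def)
  have msize: "0 < msize" using beta2_props(2) by simp
  have disj: "disjoint_family_on cls T" if "T \<subseteq> S" for T
    unfolding disjoint_family_on_def cls_def using proj_point_of_mem(1) S_sub that by blast
  have sum: "measure \<mu> (\<Union>p\<in>T. cls p) = card T / msize" if "finite T" "T \<subseteq> S" for T
  proof -
    have "measure \<mu> (\<Union>p\<in>T. cls p) = (\<Sum>p\<in>T. measure \<mu> (cls p))"
      using that disj cls(1) by (intro finite_measure_finite_Union) auto
    also have "\<dots> = (\<Sum>p\<in>T. 1 / msize)" using that cls(2) by (intro sum.cong) auto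
    finally show ?thesis by simp
  qed
  \<comment> \<open>At most \<open>msize\<close> disjoint sets of mass \<open>1 / msize\<close> fit
    into total mass 1, which also gives finiteness.\<close>
  have "finite S \<and> card S \<le> max_simplex_size DIM('k) CARD('n)"
  proof (rule finite_if_finite_subsets_card_bdd)
    fix T assume T: "T \<subseteq> S" "finite T"
    then have "card T / msize \<le> 1" using sum[of T] prob_le_1 by metis
    then show "card T \<le> max_simplex_size DIM('k) CARD('n)" using msize by (simp add: msize_eq)
  qed
  then have "finite S" ..
  have inS: "AE x in \<mu>. proj_point x \<in> S"
    using good by eventually_elim (simp add: S_def)
  \<comment> \<open>The classes exhaust the mass, so there are exactly \<open>msize\<close> of
    them.\<close>
  have "measure \<mu> (\<Union>p\<in>S. cls p) = 1"
  proof (subst prob_eq_1)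
    show "AE x in \<mu>. x \<in> (\<Union>p\<in>S. cls p)"
      using unit inS by eventually_elim (use mem_proj_point_self in \<open>force simp: cls_def\<close>)
  qed (use \<open>finite S\<close> cls in auto)
  then have "real (card S) = msize" using sum[OF \<open>finite S\<close>] msize by simp
  then have card: "card S = max_simplex_size DIM('k) CARD('n)" by (simp add: msize_eq)
  have "S \<noteq> {}" using card msize by (auto simp: msize_eq)
  have "norm (hprod x y) = sqrt beta2"
    if "p \<in> S" "p' \<in> S" "p \<noteq> p'" "x \<in> p" "y \<in> p'" "norm x = 1" "norm y = 1" for p p' x y
  proof -
    from that(1) obtain u where u: "good u" "p = proj_point u" unfolding S_def by blast
    \<comment> \<open>The dichotomy for \<open>u\<close> holds only for almost every
      \<open>z\<close>, but \<open>cls p'\<close> has positive mass and so contains a vector obeying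
      it.\<close>
    have "\<exists>z\<in>cls p'. (norm (hprod u z))\<^sup>2 = beta2 \<or> norm (hprod u z) = 1"
    proof (rule ccontr)
      assume neg: "\<not> ?thesis"
      have "AE z in \<mu>. norm z = 1 \<and> ((norm (hprod u z))\<^sup>2 = beta2 \<or> norm (hprod u z) = 1)"
        using u by (simp add: good_def)
      then have "AE z in \<mu>. z \<notin> cls p'" by eventually_elim (use neg in auto)
      then have "measure \<mu> (cls p') = 0" using cls(1)[OF that(2)] by (simp add: prob_eq_0)
      then show False using cls(2)[OF that(2)] msize by simp
    qed
    then obtain z where z: "z \<in> p'" "norm z = 1" "(norm (hprod u z))\<^sup>2 = beta2 \<or> norm (hprod u z) = 1"
      by (auto simp: cls_def)
    have p': "p' = proj_point z" "p' = proj_point y" using proj_point_of_mem(1) S_sub that z by blast+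
    have nu: "norm u = 1" using u by (simp add: good_def)
    have "norm (hprod u z) \<noteq> 1"
    proof
      assume "norm (hprod u z) = 1"
      then have "z \<in> p" using unit_proj_point_iff[OF nu z(2)] u by simp
      then show False using proj_point_of_mem(1)[of p z] p' that S_sub by auto
    qed
    then have "(norm (hprod u z))\<^sup>2 = beta2" using z by simp
    then have "norm (hprod u z) = sqrt beta2" by (metis norm_ge_zero real_sqrt_unique)
    \<comment> \<open>Unit representatives of one point differ by a scalar of norm 1, so the modulus
      passes from \<open>u\<close>, \<open>z\<close> to \<open>x\<close>, \<open>y\<close>.\<close>
    moreover have "norm (hprod u z) = norm (hprod u y)"
      using norm_hprod_proj_point[of z y u] z p' that by auto
    moreover have "norm (hprod u y) = norm (hprod x y)"
      using norm_hprod_proj_point[of x u y] u nu that by (simp add: norm_hprod_commute[of _ y])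
    ultimately show ?thesis by simp
  qed
  then have "maximal_simplex S"
    unfolding maximal_simplex_def regular_simplex_def using \<open>finite S\<close> S_sub card by blast
  moreover have "uniform_over \<mu> S"
    using \<open>finite S\<close> \<open>S \<noteq> {}\<close> S_sub unit inS cls card
    by (intro uniform_overI) (auto simp: cls_def msize_eq)
  ultimately show ?thesis by (rule that)
qed

end

text \<open>Proved once for the whole class, of which the three scalar algebras are instances; the
  constants match because the q-th power of \<beta> is \<open>beta2 powr (q / 2)\<close>.\<close>

lemma isotropic_moment_bound:
  fixes q :: real and \<mu> :: "('k::conj_div_algebra ^ 'n) measure"
  assumes "1 \<le> q" "q \<le> 2" "isotropic_measure \<mu>"
  defines "V \<equiv> simplex_beta DIM('k) CARD('n) powr q
      + (1 - simplex_beta DIM('k) CARD('n) powr q) / max_simplex_size DIM('k) CARD('n)"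
  shows "moment q \<mu> \<le> V \<and> (q < 2 \<and> moment q \<mu> = V \<longrightarrow>
    (\<exists>S :: ('k ^ 'n) set set. maximal_simplex S) \<and> (\<exists>S. maximal_simplex S \<and> uniform_over \<mu> S))"
proof -
  interpret isotropic_bound \<mu> q "real CARD('n)" "real (max_simplex_size DIM('k) CARD('n))"
    "1 / (real CARD('n) + 2 / real DIM('k))"
    using assms by unfold_locales auto
  have "simplex_beta DIM('k) CARD('n) powr q = (1 / (real CARD('n) + 2 / real DIM('k))) powr (q / 2)"
    unfolding simplex_beta_def using beta2_props(3) by (simp add: powr_half_sqrt[symmetric] powr_powr)
  then have "V = target" by (simp add: V_def target_def)
  then show ?thesis using moment_le_target moment_eq_target_simplex by blast
qed

theorem theorem4:
  fixes q :: real
  assumes "1 \<le> q" and "q \<le> 2"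
  shows "(\<forall>\<mu> :: (real ^ 'n) measure. isotropic_measure \<mu> \<longrightarrow>
        moment q \<mu> \<le> simplex_beta DIM(real) CARD('n) powr q
          + (1 - simplex_beta DIM(real) CARD('n) powr q) / max_simplex_size DIM(real) CARD('n) \<and>
        (q < 2 \<and>
         moment q \<mu> = simplex_beta DIM(real) CARD('n) powr q
          + (1 - simplex_beta DIM(real) CARD('n) powr q) / max_simplex_size DIM(real) CARD('n) \<longrightarrow>
           (\<exists>S :: (real ^ 'n) set set. maximal_simplex S) \<and>
           (\<exists>S. maximal_simplex S \<and> uniform_over \<mu> S))) \<and>
     (\<forall>\<mu> :: (complex ^ 'n) measure. isotropic_measure \<mu> \<longrightarrow>
        moment q \<mu> \<le> simplex_beta DIM(complex) CARD('n) powr q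
          + (1 - simplex_beta DIM(complex) CARD('n) powr q) / max_simplex_size DIM(complex) CARD('n) \<and>
        (q < 2 \<and>
         moment q \<mu> = simplex_beta DIM(complex) CARD('n) powr q
          + (1 - simplex_beta DIM(complex) CARD('n) powr q) / max_simplex_size DIM(complex) CARD('n) \<longrightarrow>
           (\<exists>S :: (complex ^ 'n) set set. maximal_simplex S) \<and>
           (\<exists>S. maximal_simplex S \<and> uniform_over \<mu> S))) \<and>
     (\<forall>\<mu> :: (quat ^ 'n) measure. isotropic_measure \<mu> \<longrightarrow>
        moment q \<mu> \<le> simplex_beta DIM(quat) CARD('n) powr q
          + (1 - simplex_beta DIM(quat) CARD('n) powr q) / max_simplex_size DIM(quat) CARD('n) \<and>
        (q < 2 \<and>
         moment q \<mu> = simplex_beta DIM(quat) CARD('n) powr q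
          + (1 - simplex_beta DIM(quat) CARD('n) powr q) / max_simplex_size DIM(quat) CARD('n) \<longrightarrow>
           (\<exists>S :: (quat ^ 'n) set set. maximal_simplex S) \<and>
           (\<exists>S. maximal_simplex S \<and> uniform_over \<mu> S)))"
  by (rule conjI[OF _ conjI]; intro allI impI; rule isotropic_moment_bound[OF assms])

end
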